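(* Let $(\mathbf{X},\mathbf{T})$ be a nonautonomous dynamical system and let $K\subset X_0$ be non-empty and compact. Then $$h_{\mathrm{top}}^{\mathrm{P}}(\mathbf{T},K)=\sup\{\overline{h}_{\mu}(\mathbf{T}):\mu\in M(X_0),\ \mu(K)=1\}.$$
   Context: A nonautonomous dynamical system (NDS) $(\mathbf{X},\mathbf{T})$ consists of a sequence $\mathbf{X}=\{X_k\}_{k=0}^\infty$ of compact metric spaces $(X_k,d_k)$ and a sequence $\mathbf{T}=\{T_k\}_{k=0}^\infty$ of continuous maps $T_k:X_k\to X_{k+1}$. Put $\mathbf{T}^0=\mathrm{id}_{X_0}$ and $\mathbf{T}^j=T_{j-1}\circ\cdots\circ T_0:X_0\to X_j$. For $n\ge1$ and $x,y\in X_0$ let $d_n^{\mathbf{T}}(x,y)=\max_{0\le j\le n-1}d_j(\mathbf{T}^jx,\mathbf{T}^jy)$, and for $\varepsilon>0$ let $B_n^{\mathbf{T}}(x,\varepsilon)$, $\overline{B}_n^{\mathbf{T}}(x,\varepsilon)$ be the sets of $y\in X_0$ with $d_n^{\mathbf{T}}(x,y)<\varepsilon$, respectively $\le\varepsilon$. $M(X_0)$ is the set of Borel probability measures on $X_0$. Measure-theoretic upper entropy: $\overline{h}_\mu(\mathbf{T})=\int_{X_0}\overline{h}_\mu(\mathbf{T},x)\,d\mu(x)$, where $\overline{h}_\mu(\mathbf{T},x)=\lim_{\varepsilon\to0}\limsup_{n\to\infty}\frac{-\log\mu(B_n^{\mathbf{T}}(x,\varepsilon))}{n}$, with $\log0=-\infty$.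 Packing entropy: for $Z\subset X_0$, an $(N,\varepsilon)$-packing of $Z$ is a family of pairwise disjoint closed Bowen balls $\{\overline{B}_{n_i}^{\mathbf{T}}(x_i,\varepsilon)\}_i$ with $x_i\in Z$ and integers $n_i\ge N$. For $s\in\mathbb{R}$, $N,\varepsilon>0$ let $\mathscr{P}_{N,\varepsilon}^{s}(\mathbf{T},\mathbf{0},Z)=\sup\sum_i\exp(-n_is)$ over all countable (finite or infinite) $(N,\varepsilon)$-packings of $Z$; $\mathscr{P}_{\infty,\varepsilon}^{s}=\lim_{N\to\infty}\mathscr{P}_{N,\varepsilon}^{s}$; $\mathscr{P}_{\varepsilon}^{s}(\mathbf{T},\mathbf{0},Z)=\inf\{\sum_{i=1}^\infty\mathscr{P}_{\infty,\varepsilon}^{s}(\mathbf{T},\mathbf{0},Z_i):\bigcup_iZ_i\supseteq Z\}$; $h_{\mathrm{top}}^{\mathrm{P}}(\mathbf{T},Z)=\lim_{\varepsilon\to0}\inf\{s:\mathscr{P}_{\varepsilon}^{s}(\mathbf{T},\mathbf{0},Z)=0\}$ (monotone limit). *)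

theory Defs
  imports "HOL-Probability.Probability"
begin

(* The spaces X k are metrics on subsets of one type 'a.  This loses no generality, since
   differently typed spaces embed into the type of their disjoint union; the T k matter only on mspace (X k). *)

definition nds :: "(nat \<Rightarrow> 'a metric) \<Rightarrow> (nat \<Rightarrow> 'a \<Rightarrow> 'a) \<Rightarrow> bool" where
  "nds X T \<longleftrightarrow>
     (\<forall>k. compact_space (mtopology_of (X k))) \<and>
     (\<forall>k. continuous_map (mtopology_of (X k)) (mtopology_of (X (Suc k))) (T k))"

primrec nds_iter :: "(nat \<Rightarrow> 'a \<Rightarrow> 'a) \<Rightarrow> nat \<Rightarrow> 'a \<Rightarrow> 'a" where
  "nds_iter T 0 = id"
| "nds_iter T (Suc j) = T j \<circ> nds_iter T j"

(* Meaningful for n \<ge> 1 only; index 0 never affects the entropies below. *)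
definition bowen_dist ::
    "(nat \<Rightarrow> 'a metric) \<Rightarrow> (nat \<Rightarrow> 'a \<Rightarrow> 'a) \<Rightarrow> nat \<Rightarrow> 'a \<Rightarrow> 'a \<Rightarrow> real" where
  "bowen_dist X T n x y = (MAX j\<in>{..<n}. mdist (X j) (nds_iter T j x) (nds_iter T j y))"

definition bowen_ball ::
    "(nat \<Rightarrow> 'a metric) \<Rightarrow> (nat \<Rightarrow> 'a \<Rightarrow> 'a) \<Rightarrow> nat \<Rightarrow> 'a \<Rightarrow> real \<Rightarrow> 'a set" where
  "bowen_ball X T n x \<epsilon> = {y \<in> mspace (X 0). bowen_dist X T n x y < \<epsilon>}"

definition bowen_cball ::
    "(nat \<Rightarrow> 'a metric) \<Rightarrow> (nat \<Rightarrow> 'a \<Rightarrow> 'a) \<Rightarrow> nat \<Rightarrow> 'a \<Rightarrow> real \<Rightarrow> 'a set" where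
  "bowen_cball X T n x \<epsilon> = {y \<in> mspace (X 0). bowen_dist X T n x y \<le> \<epsilon>}"

definition borel_probs :: "'a metric \<Rightarrow> 'a measure set" where
  "borel_probs m = {\<mu>. prob_space \<mu> \<and> space \<mu> = mspace m \<and>
     sets \<mu> = sigma_sets (mspace m) {U. openin (mtopology_of m) U}}"

(* The library has ln 0 = 0; here log 0 is minus infinity. *)
definition elog :: "real \<Rightarrow> ereal" where
  "elog p = (if p = 0 then - \<infinity> else ereal (ln p))"

definition local_upper_entropy ::
    "(nat \<Rightarrow> 'a metric) \<Rightarrow> (nat \<Rightarrow> 'a \<Rightarrow> 'a) \<Rightarrow> 'a measure \<Rightarrow> 'a \<Rightarrow> ereal" where
  "local_upper_entropy X T \<mu> x =
     Lim (at_right 0) (\<lambda>\<epsilon>. limsup (\<lambda>n. - elog (measure \<mu> (bowen_ball X T n x \<epsilon>)) / ereal (real n)))"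

(* For a probability measure the local entropy is nonnegative, so e2ennreal truncates nothing. *)
definition upper_entropy ::
    "(nat \<Rightarrow> 'a metric) \<Rightarrow> (nat \<Rightarrow> 'a \<Rightarrow> 'a) \<Rightarrow> 'a measure \<Rightarrow> ereal" where
  "upper_entropy X T \<mu> = enn2ereal (\<integral>\<^sup>+ x. e2ennreal (local_upper_entropy X T \<mu> x) \<partial>\<mu>)"

(* A countable packing is a family indexed by a subset I of the naturals; the i-th ball has
   order n i and centre x i. *)
definition is_packing ::
    "(nat \<Rightarrow> 'a metric) \<Rightarrow> (nat \<Rightarrow> 'a \<Rightarrow> 'a) \<Rightarrow> nat \<Rightarrow> real \<Rightarrow> 'a set \<Rightarrow>
     nat set \<Rightarrow> (nat \<Rightarrow> nat) \<Rightarrow> (nat \<Rightarrow> 'a) \<Rightarrow> bool" where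
  "is_packing X T N \<epsilon> Z I n x \<longleftrightarrow>
     (\<forall>i\<in>I. x i \<in> Z \<and> n i \<ge> N) \<and>
     disjoint_family_on (\<lambda>i. bowen_cball X T (n i) (x i) \<epsilon>) I"

definition packing_pre ::
    "(nat \<Rightarrow> 'a metric) \<Rightarrow> (nat \<Rightarrow> 'a \<Rightarrow> 'a) \<Rightarrow> nat \<Rightarrow> real \<Rightarrow> real \<Rightarrow> 'a set \<Rightarrow> ennreal" where
  "packing_pre X T N \<epsilon> s Z =
     Sup {(\<Sum>\<^sub>\<infinity>i\<in>I. ennreal (exp (- real (n i) * s))) | I n x. is_packing X T N \<epsilon> Z I n x}"

definition packing_pre_inf ::
    "(nat \<Rightarrow> 'a metric) \<Rightarrow> (nat \<Rightarrow> 'a \<Rightarrow> 'a) \<Rightarrow> real \<Rightarrow> real \<Rightarrow> 'a set \<Rightarrow> ennreal" where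
  "packing_pre_inf X T \<epsilon> s Z = Lim sequentially (\<lambda>N. packing_pre X T N \<epsilon> s Z)"

definition packing_outer ::
    "(nat \<Rightarrow> 'a metric) \<Rightarrow> (nat \<Rightarrow> 'a \<Rightarrow> 'a) \<Rightarrow> real \<Rightarrow> real \<Rightarrow> 'a set \<Rightarrow> ennreal" where
  "packing_outer X T \<epsilon> s Z =
     Inf {(\<Sum>i. packing_pre_inf X T \<epsilon> s (W i)) | W :: nat \<Rightarrow> 'a set.
            (\<forall>i. W i \<subseteq> mspace (X 0)) \<and> Z \<subseteq> (\<Union>i. W i)}"

definition packing_entropy ::
    "(nat \<Rightarrow> 'a metric) \<Rightarrow> (nat \<Rightarrow> 'a \<Rightarrow> 'a) \<Rightarrow> 'a set \<Rightarrow> ereal" where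
  "packing_entropy X T Z =
     Lim (at_right 0) (\<lambda>\<epsilon>. Inf {ereal s | s. packing_outer X T \<epsilon> s Z = 0})"

end

(* The inequality "sup <= packing entropy": Bowen balls of larger order are smaller in a monotone
   family of metrics, so a greedy choice by increasing order gives a 3r-covering lemma, and the mass
   distribution principle bounds the outer measure of every piece of a cover by its packing sums.

   The inequality "packing entropy <= sup" (after Joyce-Preiss and Feng-Huang): if s is below the
   packing entropy at scale e, then K is not a countable union of sets with finite packing sums of
   exponent s, and removing the open part where it is leaves a set Z all of whose local pieces admit
   finite packings with arbitrarily large packing sums.  Iterating, each point x of order m x in a
   finite stage is replaced by a packing near x with total weight at least exp (- m x * s).  Instead
   of weak limits of the stage measures, the unit interval is partitioned along the tree of stages,
   giving x a piece of length at most exp (- m x * s); the nested limit map pushes the uniform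
   measure forward to a measure whose Bowen balls of order m x at scale e have mass at most
   exp (- m x * s). *)
theory Submission
  imports Defs
begin

text \<open>Whatever lies below the supremum is exceeded at some \<open>e\<close> and hence on all
  of the interval from 0 to \<open>e\<close>, so the limit exists. Both entropies are defined by
  such a \<open>Lim\<close> and are handled as suprema over the scale from here on.\<close>

lemma Lim_at_right_0_antitone:
  fixes f :: "real \<Rightarrow> ereal"
  assumes anti: "\<And>a b. 0 < a \<Longrightarrow> a \<le> b \<Longrightarrow> f b \<le> f a"
  shows "Lim (at_right 0) f = (SUP e\<in>{0<..}. f e)"
proof (rule tendsto_Lim)
  show "(f \<longlongrightarrow> (SUP e\<in>{0<..}. f e)) (at_right 0)"
  proof (rule order_tendstoI)
    fix y assume "y < (SUP e\<in>{0<..}. f e)"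
    then obtain e where "e > 0" "y < f e"
      by (auto simp: less_SUP_iff)
    moreover have "eventually (\<lambda>a. 0 < a \<and> a < e) (at_right 0)"
      using \<open>e > 0\<close> by (auto simp: eventually_at_right_field)
    ultimately show "eventually (\<lambda>a. y < f a) (at_right 0)"
      by (elim eventually_mono) (metis anti less_imp_le less_le_trans)
  next
    fix y assume *: "(SUP e\<in>{0<..}. f e) < y"
    have "eventually (\<lambda>a::real. 0 < a) (at_right 0)"
      by (simp add: eventually_at_right_less)
    then show "eventually (\<lambda>a. f a < y) (at_right 0)"
      by (elim eventually_mono) (metis * SUP_upper greaterThan_iff le_less_trans)
  qed
qed simp

section \<open>Translation between the extended logarithm and exponential mass bounds\<close>

lemma elog_mono: "0 \<le> p \<Longrightarrow> p \<le> q \<Longrightarrow> elog p \<le> elog q"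
  by (auto simp: elog_def)

lemma elog_le_0: "0 \<le> p \<Longrightarrow> p \<le> 1 \<Longrightarrow> elog p \<le> 0"
  by (auto simp: elog_def)

lemma less_minus_elog_divideD:
  assumes "ereal s < - elog p / ereal (real n)" "n > 0" "p \<ge> 0"
  shows "p \<le> exp (- real n * s)"
proof (cases "p = 0")
  case False
  with assms have "s < - ln p / real n"
    by (simp add: elog_def)
  then have "ln p \<le> - real n * s"
    using assms(2) by (simp add: field_simps)
  then have "exp (ln p) \<le> exp (- real n * s)"
    by (subst exp_le_cancel_iff)
  then show ?thesis
    using False assms(3) by simp
qed simp

lemma le_minus_elog_divide:
  assumes "p \<le> exp (- real n * s)" "n > 0" "p \<ge> 0"
  shows "ereal s \<le> - elog p / ereal (real n)"
proof (cases "p = 0")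
  case True
  then show ?thesis
    using assms(2) by (simp add: elog_def)
next
  case False
  with assms have "ln p \<le> ln (exp (- real n * s))"
    by (subst ln_le_cancel_iff) auto
  then have "s \<le> - ln p / real n"
    using assms(2) by (simp add: field_simps)
  with False assms(2) show ?thesis
    by (simp add: elog_def)
qed

subsection \<open>Partitions of the unit interval\<close>

text \<open>The underlying space is the whole line, with the mass on the interval, so that the stage
  maps can be total functions and their fibres need no restriction.\<close>

definition unit_uniform :: "real measure" where
  "unit_uniform = uniform_measure lborel {0..1}"

lemma space_unit_uniform [simp]: "space unit_uniform = UNIV"
  and sets_unit_uniform [simp, measurable_cong]: "sets unit_uniform = sets borel"
  by (simp_all add: unit_uniform_def)

lemma measure_unit_uniform:
  "S \<in> sets borel \<Longrightarrow> measure unit_uniform S = measure lborel ({0..1} \<inter> S)"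
  unfolding unit_uniform_def by (subst measure_uniform_measure) auto

lemma prob_space_unit_uniform: "prob_space unit_uniform"
  unfolding unit_uniform_def by (rule prob_space_uniform_measure) auto

text \<open>The mass of \<open>A\<close> to the left of a moving cut is a 1-Lipschitz function
  rising from 0 to the mass of \<open>A\<close>; the intermediate value theorem finds the
  cut.\<close>

lemma unit_uniform_ex_measure_eq:
  assumes A: "A \<in> sets borel" and c: "0 \<le> c" "c \<le> measure unit_uniform A"
  shows "\<exists>B\<in>sets borel. B \<subseteq> A \<and> measure unit_uniform B = c"
proof -
  interpret prob_space unit_uniform
    by (rule prob_space_unit_uniform)
  let ?U = unit_uniform
  define g where "g t = measure ?U (A \<inter> {..t})" for t
  note eq = measure_unit_uniform
  have diff: "\<bar>g t - g t'\<bar> \<le> \<bar>t - t'\<bar>" if "t' \<le> t" for t t'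
  proof -
    have "A \<inter> {..t} = (A \<inter> {..t'}) \<union> (A \<inter> {t'<..t})"
      using that by auto
    then have "g t = g t' + measure ?U (A \<inter> {t'<..t})"
      unfolding g_def using A by (simp only:) (subst finite_measure_Union, auto)
    moreover have "measure ?U (A \<inter> {t'<..t}) = measure lborel ({0..1} \<inter> (A \<inter> {t'<..t}))"
      using A by (intro eq) auto
    moreover have "\<dots> \<le> measure lborel {t'<..t}"
      using A that by (intro measure_mono_fmeasurable fmeasurableI) auto
    ultimately show ?thesis
      using that by simp
  qed
  have "\<bar>g t - g t'\<bar> \<le> \<bar>t - t'\<bar>" for t t'
    using diff[of t t'] diff[of t' t] by (cases "t \<le> t'") (auto simp: abs_minus_commute)
  then have "1-lipschitz_on {0..1} g"
    by (auto simp: lipschitz_on_def dist_real_def)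
  then have "continuous_on {0..1} g"
    by (rule lipschitz_on_continuous_on)
  moreover have "g 0 = 0"
  proof -
    have "g 0 = measure lborel ({0..1} \<inter> (A \<inter> {..0}))"
      unfolding g_def using A by (intro eq) auto
    also have "\<dots> \<le> measure lborel {0::real}"
      using A by (intro measure_mono_fmeasurable fmeasurableI) auto
    finally have "g 0 \<le> measure lborel {0::real}" .
    then show ?thesis
      by (simp add: g_def measure_le_0_iff)
  qed
  moreover have "g 1 = measure ?U A"
    unfolding g_def using A by (simp add: eq, intro arg_cong[where f="measure lborel"]) auto
  ultimately obtain t where "g t = c"
    using IVT'[of g 0 c 1] c by auto
  then show ?thesis
    using A by (intro bexI[of _ "A \<inter> {..t}"]) (auto simp: g_def)
qed

text \<open>Greedy cutting: each point takes as much of the remaining set as its weight allows. Only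
  upper bounds on the pieces are wanted, so surplus weight is harmless.\<close>

lemma unit_uniform_ex_partition:
  assumes "finite E" "E \<noteq> {}" "A \<in> sets borel" "measure unit_uniform A \<le> (\<Sum>y\<in>E. w y)"
    and "\<And>y. y \<in> E \<Longrightarrow> (0::real) \<le> w y"
  shows "\<exists>g. (\<forall>u\<in>A. g u \<in> E) \<and> (\<forall>y\<in>E. {u\<in>A. g u = y} \<in> sets borel \<and>
    measure unit_uniform {u\<in>A. g u = y} \<le> w y)"
  using assms
proof (induction E arbitrary: A rule: finite_ne_induct)
  case (singleton y)
  then show ?case
    by (intro exI[of _ "\<lambda>_. y"]) auto
next
  case (insert y F)
  interpret prob_space unit_uniform
    by (rule prob_space_unit_uniform)
  \<comment> \<open>The minimum covers the case that \<open>A\<close> runs out: \<open>B\<close>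
    then takes the full mass of \<open>A\<close>, and the other points share a null set.\<close>
  define c where "c = min (w y) (measure unit_uniform A)"
  have c: "0 \<le> c" "c \<le> w y" "c \<le> measure unit_uniform A"
    using insert.prems(3)[of y] by (auto simp: c_def)
  obtain B where B: "B \<in> sets borel" "B \<subseteq> A" "measure unit_uniform B = c"
    using unit_uniform_ex_measure_eq[OF insert.prems(1) c(1,3)] by blast
  have "measure unit_uniform (A - B) = measure unit_uniform A - c"
    using B insert.prems(1) by (subst finite_measure_Diff) auto
  also have "\<dots> \<le> (\<Sum>y\<in>F. w y)"
  proof (cases "w y \<le> measure unit_uniform A")
    case True
    then show ?thesis
      using insert.prems(2) insert.hyps by (simp add: c_def)
  next
    case False
    then show ?thesis
      using insert.prems(3) by (simp add: c_def sum_nonneg)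
  qed
  finally have "\<exists>g. (\<forall>u\<in>A - B. g u \<in> F) \<and> (\<forall>y\<in>F. {u\<in>A - B. g u = y} \<in> sets borel \<and>
    measure unit_uniform {u\<in>A - B. g u = y} \<le> w y)"
    using insert.prems B(1) by (intro insert.IH) auto
  then obtain g where g: "\<And>u. u \<in> A - B \<Longrightarrow> g u \<in> F"
    "\<And>y. y \<in> F \<Longrightarrow> {u\<in>A - B. g u = y} \<in> sets borel \<and> measure unit_uniform {u\<in>A - B. g u = y} \<le> w y"
    by blast
  define h where "h u = (if u \<in> B then y else g u)" for u
  have "{u\<in>A. h u = y} = B"
    using B(2) g(1) insert.hyps by (auto simp: h_def)
  moreover have "{u\<in>A. h u = z} = {u\<in>A - B. g u = z}" if "z \<in> F" for z
    using that insert.hyps by (auto simp: h_def)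
  moreover have "\<forall>u\<in>A. h u \<in> insert y F"
    using g(1) by (auto simp: h_def)
  ultimately show ?case
    using g(2) B c by (intro exI[of _ h]) auto
qed

subsection \<open>Bowen metrics\<close>

locale nonautonomous_system =
  fixes X :: "nat \<Rightarrow> 'a metric" and T :: "nat \<Rightarrow> 'a \<Rightarrow> 'a"
  assumes nds: "nds X T"
begin

abbreviation "M \<equiv> mspace (X 0)"
abbreviation "d \<equiv> mdist (X 0)"
abbreviation "D \<equiv> bowen_dist X T"
abbreviation "B \<equiv> bowen_ball X T"
abbreviation "CB \<equiv> bowen_cball X T"

interpretation X0: Metric_space M d
  by simp

lemma mtopology_eq: "X0.mtopology = mtopology_of (X 0)"
  by (simp add: mtopology_of_def)

lemma continuous_nds_iter: "continuous_map (mtopology_of (X 0)) (mtopology_of (X j)) (nds_iter T j)"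
proof (induction j)
  case (Suc j)
  have "continuous_map (mtopology_of (X j)) (mtopology_of (X (Suc j))) (T j)"
    using nds by (simp add: nds_def)
  with Suc show ?case
    using continuous_map_compose[of _ _ "nds_iter T j"] by (simp only: nds_iter.simps)
qed simp

lemma nds_iter_in: "x \<in> M \<Longrightarrow> nds_iter T j x \<in> mspace (X j)"
  using continuous_map_image_subset_topspace[OF continuous_nds_iter, of j] by auto

lemma bowen_dist_le_iff:
  "n > 0 \<Longrightarrow> D n x y \<le> r \<longleftrightarrow> (\<forall>j<n. mdist (X j) (nds_iter T j x) (nds_iter T j y) \<le> r)"
  unfolding bowen_dist_def by (subst Max_le_iff) auto

lemma bowen_dist_less_iff:
  "n > 0 \<Longrightarrow> D n x y < r \<longleftrightarrow> (\<forall>j<n. mdist (X j) (nds_iter T j x) (nds_iter T j y) < r)"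
  unfolding bowen_dist_def by (subst Max_less_iff) auto

lemma bowen_dist_commute: "D n x y = D n y x"
  unfolding bowen_dist_def by (subst mdist_commute) (rule refl)

lemma mdist_iter_le_bowen_dist:
  "j < n \<Longrightarrow> mdist (X j) (nds_iter T j x) (nds_iter T j y) \<le> D n x y"
  unfolding bowen_dist_def by (intro Max_ge) auto

lemma bowen_dist_mono: "0 < m \<Longrightarrow> m \<le> n \<Longrightarrow> D m x y \<le> D n x y"
  by (simp add: bowen_dist_le_iff mdist_iter_le_bowen_dist)

lemma bowen_dist_self: "n > 0 \<Longrightarrow> x \<in> M \<Longrightarrow> D n x x = 0"
proof (rule antisym)
  assume "n > 0" "x \<in> M"
  then show "D n x x \<le> 0"
    by (auto simp: bowen_dist_le_iff nds_iter_in mdist_zero[THEN iffD2])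
  show "0 \<le> D n x x"
    by (rule order_trans[OF mdist_nonneg mdist_iter_le_bowen_dist[OF \<open>n > 0\<close>]])
qed

lemma bowen_dist_triangle:
  assumes "n > 0" "x \<in> M" "y \<in> M" "z \<in> M"
  shows "D n x z \<le> D n x y + D n y z"
  unfolding bowen_dist_le_iff[OF assms(1)]
proof (intro allI impI)
  fix j assume "j < n"
  have "mdist (X j) (nds_iter T j x) (nds_iter T j z) \<le>
      mdist (X j) (nds_iter T j x) (nds_iter T j y) + mdist (X j) (nds_iter T j y) (nds_iter T j z)"
    using assms by (intro mdist_triangle nds_iter_in)
  also have "\<dots> \<le> D n x y + D n y z"
    using \<open>j < n\<close> by (intro add_mono mdist_iter_le_bowen_dist)
  finally show "mdist (X j) (nds_iter T j x) (nds_iter T j z) \<le> D n x y + D n y z" .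
qed

lemma centre_in_bowen_ball: "n > 0 \<Longrightarrow> x \<in> M \<Longrightarrow> e > 0 \<Longrightarrow> x \<in> B n x e"
  by (simp add: bowen_ball_def bowen_dist_self)

lemma centre_in_bowen_cball: "n > 0 \<Longrightarrow> x \<in> M \<Longrightarrow> e \<ge> 0 \<Longrightarrow> x \<in> CB n x e"
  by (simp add: bowen_cball_def bowen_dist_self)

text \<open>A finite intersection of preimages of open balls under the continuous iterates.\<close>

lemma openin_bowen_ball:
  assumes "n > 0" "x \<in> M"
  shows "openin (mtopology_of (X 0)) (B n x e)"
proof -
  have "openin (mtopology_of (X 0)) {y \<in> M. nds_iter T j y \<in> mball_of (X j) (nds_iter T j x) e}" for j
    using openin_continuous_map_preimage[OF continuous_nds_iter, of j "mball_of (X j) (nds_iter T j x) e"]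
    by (simp add: mball_of_def mtopology_of_def Metric_space.openin_mball)
  then have "openin (mtopology_of (X 0))
      (\<Inter>j\<in>{..<n}. {y \<in> M. nds_iter T j y \<in> mball_of (X j) (nds_iter T j x) e})"
    using assms by (intro openin_INT2) auto
  also have "(\<Inter>j\<in>{..<n}. {y \<in> M. nds_iter T j y \<in> mball_of (X j) (nds_iter T j x) e}) = B n x e"
    using assms nds_iter_in by (auto simp: bowen_ball_def bowen_dist_less_iff)
  finally show ?thesis .
qed

text \<open>Openness of the Bowen ball, in the closed-ball form that the separation argument
  uses.\<close>

lemma bowen_dist_small:
  assumes "n > 0" "x \<in> M" "e > 0"
  shows "\<exists>r>0. \<forall>y\<in>M. d x y \<le> r \<longrightarrow> D n x y < e"
proof -
  have "x \<in> B n x e"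
    by (simp add: assms centre_in_bowen_ball)
  then obtain r where "r > 0" "X0.mcball x r \<subseteq> B n x e"
    using openin_bowen_ball[OF assms(1,2), of e] unfolding mtopology_eq[symmetric]
    by (meson X0.openin_mtopology_mcball)
  then show ?thesis
    using assms(2) by (auto simp: bowen_ball_def subset_iff)
qed

text \<open>Total boundedness gives a finite net at every scale \<open>1 / real (Suc k)\<close>, and
  their union is dense. The countability arguments below rest on this set.\<close>

lemma ex_countable_dense:
  "\<exists>Q. countable Q \<and> Q \<subseteq> M \<and> (\<forall>x\<in>M. \<forall>r>0. \<exists>q\<in>Q. d q x < r)"
proof -
  have "compact_space X0.mtopology"
    using nds by (simp add: nds_def mtopology_eq)
  then have "X0.mtotally_bounded M"
    by (simp add: X0.compact_space_eq_mcomplete_mtotally_bounded)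
  then have "\<forall>k::nat. \<exists>F. finite F \<and> F \<subseteq> M \<and> M \<subseteq> (\<Union>x\<in>F. X0.mball x (1 / real (Suc k)))"
    unfolding X0.mtotally_bounded_def by simp
  then obtain F where F: "\<And>k. finite (F k)" "\<And>k. F k \<subseteq> M"
    "\<And>k. M \<subseteq> (\<Union>x\<in>F k. X0.mball x (1 / real (Suc k)))"
    by metis
  have "\<exists>q\<in>(\<Union>k. F k). d q x < r" if "x \<in> M" "r > 0" for x r
  proof -
    obtain k where k: "1 / real (Suc k) < r"
      using nat_approx_posE[OF \<open>r > 0\<close>] by blast
    obtain q where "q \<in> F k" "x \<in> X0.mball q (1 / real (Suc k))"
      using F(3)[of k] \<open>x \<in> M\<close> by blast
    then have "d q x < r"
      using k by simp
    with \<open>q \<in> F k\<close> show ?thesis by blast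
  qed
  moreover have "countable (\<Union>k. F k)" "(\<Union>k. F k) \<subseteq> M"
    using F(1,2) by (auto intro: countable_UN countable_finite[OF F(1)])
  ultimately show ?thesis by blast
qed

subsection \<open>Packing sums\<close>

lemma is_packing_mono:
  assumes "is_packing X T N' b Z I n x" "N \<le> N'" "a \<le> b" "Z \<subseteq> Z'"
  shows "is_packing X T N a Z' I n x"
proof -
  have "bowen_cball X T (n i) (x i) a \<subseteq> bowen_cball X T (n i) (x i) b" for i
    using assms(3) by (auto simp: bowen_cball_def)
  then have "disjoint_family_on (\<lambda>i. bowen_cball X T (n i) (x i) a) I"
    using assms(1) unfolding is_packing_def disjoint_family_on_def by blast
  then show ?thesis
    using assms by (auto simp: is_packing_def)
qed

lemma is_packing_subset: "is_packing X T N e Z I n x \<Longrightarrow> J \<subseteq> I \<Longrightarrow> is_packing X T N e Z J n x"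
  unfolding is_packing_def by (auto intro: disjoint_family_on_mono)

text \<open>An infinite sum of nonnegative terms is the supremum of its finite partial sums, and
  subfamilies of packings are packings.\<close>

lemma packing_pre_finite:
  "packing_pre X T N e s Z =
     Sup {ennreal (\<Sum>i\<in>I. exp (- real (n i) * s)) | I n x. finite I \<and> is_packing X T N e Z I n x}"
proof (rule antisym)
  show "packing_pre X T N e s Z \<le>
     Sup {ennreal (\<Sum>i\<in>I. exp (- real (n i) * s)) | I n x. finite I \<and> is_packing X T N e Z I n x}" (is "_ \<le> Sup ?S")
    unfolding packing_pre_def
  proof (rule Sup_least, clarify)
    fix I n x assume p: "is_packing X T N e Z I n x"
    show "(\<Sum>\<^sub>\<infinity>i\<in>I. ennreal (exp (- real (n i) * s))) \<le> Sup ?S"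
    proof (subst nonneg_infsum_complete, simp, rule SUP_least, clarify)
      fix J assume "finite J" "J \<subseteq> I"
      then show "(\<Sum>i\<in>J. ennreal (exp (- real (n i) * s))) \<le> Sup ?S"
        using is_packing_subset[OF p, of J] by (intro Sup_upper) (auto simp: sum_ennreal)
    qed
  qed
  show "Sup ?S \<le> packing_pre X T N e s Z"
    unfolding packing_pre_def
    by (intro Sup_subset_mono) (force simp: sum_ennreal)
qed

lemma packing_pre_mono:
  assumes "N \<le> N'" "a \<le> b" "Z \<subseteq> Z'"
  shows "packing_pre X T N' b s Z \<le> packing_pre X T N a s Z'"
  unfolding packing_pre_def using is_packing_mono[OF _ assms] by (intro Sup_subset_mono) blast

text \<open>Raising the exponent multiplies the term of order \<open>n i\<close> by
  \<open>exp (- real (n i) * (t - s))\<close>, and every order is at least \<open>N\<close>.\<close>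

lemma packing_pre_exponent:
  assumes "s \<le> t"
  shows "packing_pre X T N e t Z \<le> ennreal (exp (- real N * (t - s))) * packing_pre X T N e s Z"
  unfolding packing_pre_finite[of N e t]
proof (rule Sup_least, clarify)
  fix I :: "nat set" and n x assume I: "finite I" and p: "is_packing X T N e Z I n x"
  have "exp (- real (n i) * t) \<le> exp (- real N * (t - s)) * exp (- real (n i) * s)" if "i \<in> I" for i
  proof -
    have "real N * (t - s) \<le> real (n i) * (t - s)"
      using p that assms by (intro mult_right_mono) (auto simp: is_packing_def)
    then show ?thesis
      by (simp add: algebra_simps flip: exp_add)
  qed
  then have "(\<Sum>i\<in>I. exp (- real (n i) * t)) \<le> exp (- real N * (t - s)) * (\<Sum>i\<in>I. exp (- real (n i) * s))"
    by (auto simp: sum_distrib_left intro: sum_mono)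
  then have "ennreal (\<Sum>i\<in>I. exp (- real (n i) * t))
     \<le> ennreal (exp (- real N * (t - s))) * ennreal (\<Sum>i\<in>I. exp (- real (n i) * s))"
    by (metis ennreal_leI ennreal_mult' exp_ge_zero)
  also have "\<dots> \<le> ennreal (exp (- real N * (t - s))) * packing_pre X T N e s Z"
    unfolding packing_pre_finite using I p by (intro mult_left_mono Sup_upper) (blast | simp)+
  finally show "ennreal (\<Sum>i\<in>I. exp (- real (n i) * t))
     \<le> ennreal (exp (- real N * (t - s))) * packing_pre X T N e s Z" .
qed

lemma packing_pre_inf_eq_INF: "packing_pre_inf X T e s Z = (INF N. packing_pre X T N e s Z)"
  unfolding packing_pre_inf_def
  by (intro limI LIMSEQ_INF) (auto simp: decseq_def intro: packing_pre_mono)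

lemma packing_pre_inf_empty: "packing_pre_inf X T e s {} = 0"
proof -
  have "packing_pre X T N e s {} \<le> 0" for N
    unfolding packing_pre_def is_packing_def
    by (rule Sup_least) auto
  then show ?thesis
    by (simp add: packing_pre_inf_eq_INF)
qed

lemma packing_pre_inf_mono:
  assumes "a \<le> b" "s \<le> t" "Z \<subseteq> Z'"
  shows "packing_pre_inf X T b t Z \<le> packing_pre_inf X T a s Z'"
  unfolding packing_pre_inf_eq_INF
proof (intro INF_mono bexI)
  fix N
  have "packing_pre X T N b t Z \<le> ennreal (exp (- real N * (t - s))) * packing_pre X T N b s Z"
    by (rule packing_pre_exponent[OF assms(2)])
  also have "\<dots> \<le> 1 * packing_pre X T N b s Z"
    using assms(2) by (intro mult_right_mono) auto
  also have "\<dots> \<le> packing_pre X T N a s Z'"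
    using assms by (auto intro: packing_pre_mono)
  finally show "packing_pre X T N b t Z \<le> packing_pre X T N a s Z'" .
qed simp

lemma packing_outer_mono:
  assumes "a \<le> b" "s \<le> t"
  shows "packing_outer X T b t Z \<le> packing_outer X T a s Z"
  unfolding packing_outer_def
proof (rule Inf_mono, clarify)
  fix W :: "nat \<Rightarrow> 'a set" assume "\<forall>i. W i \<subseteq> M" "Z \<subseteq> (\<Union>i. W i)"
  then show "\<exists>a'\<in>{\<Sum>i. packing_pre_inf X T b t (W i) |W. (\<forall>i. W i \<subseteq> M) \<and> Z \<subseteq> \<Union> (range W)}.
        a' \<le> (\<Sum>i. packing_pre_inf X T a s (W i))"
    using assms by (intro bexI[of _ "\<Sum>i. packing_pre_inf X T b t (W i)"] suminf_le)
      (auto intro: packing_pre_inf_mono)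
qed

lemma packing_entropy_eq_SUP:
  "packing_entropy X T Z = (SUP e\<in>{0<..}. Inf {ereal s | s. packing_outer X T e s Z = 0})"
  unfolding packing_entropy_def
proof (rule Lim_at_right_0_antitone)
  fix a b :: real assume "a \<le> b"
  have "packing_outer X T b s Z = 0" if "packing_outer X T a s Z = 0" for s
    using packing_outer_mono[OF \<open>a \<le> b\<close> order_refl, of s Z] that by simp
  then show "Inf {ereal s |s. packing_outer X T b s Z = 0} \<le> Inf {ereal s |s. packing_outer X T a s Z = 0}"
    by (intro Inf_superset_mono) blast
qed

text \<open>The jump at the critical exponent: once the sums of exponent \<open>s\<close> are
  bounded, those of exponent \<open>t\<close> carry an extra factor that decays geometrically in
  \<open>N\<close>.\<close>

lemma packing_pre_inf_exponent:
  assumes "s < t" "packing_pre_inf X T e s Z < \<infinity>"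
  shows "packing_pre_inf X T e t Z = 0"
proof -
  obtain N0 where N0: "packing_pre X T N0 e s Z < \<infinity>"
    using assms(2) unfolding packing_pre_inf_eq_INF INF_less_iff by auto
  then obtain c where c: "packing_pre X T N0 e s Z = ennreal c" "c \<ge> 0"
    by (cases "packing_pre X T N0 e s Z") auto
  have "packing_pre_inf X T e t Z \<le> ennreal (exp (- real N * (t - s)) * c)" if "N \<ge> N0" for N
  proof -
    have "packing_pre_inf X T e t Z \<le> packing_pre X T N e t Z"
      unfolding packing_pre_inf_eq_INF by (rule INF_lower) simp
    also have "\<dots> \<le> ennreal (exp (- real N * (t - s))) * packing_pre X T N e s Z"
      using assms(1) by (intro packing_pre_exponent) simp
    also have "\<dots> \<le> ennreal (exp (- real N * (t - s))) * ennreal c"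
      unfolding c(1)[symmetric] using that by (intro mult_left_mono packing_pre_mono) auto
    finally show ?thesis
      using c(2) by (simp add: ennreal_mult)
  qed
  moreover have "(\<lambda>N. ennreal (exp (- real N * (t - s)) * c)) \<longlonglongrightarrow> ennreal 0"
  proof (rule tendsto_ennrealI)
    have "(\<lambda>N. exp (- (t - s)) ^ N * c) \<longlonglongrightarrow> 0 * c"
      using assms(1) by (intro tendsto_mult LIMSEQ_power_zero) auto
    then show "(\<lambda>N. exp (- real N * (t - s)) * c) \<longlonglongrightarrow> 0"
      by (simp add: exp_of_nat_mult[symmetric] algebra_simps)
  qed
  ultimately have "packing_pre_inf X T e t Z \<le> ennreal 0"
    by (intro LIMSEQ_le_const[of _ _ "packing_pre_inf X T e t Z"]) auto
  then show ?thesis by simp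
qed

text \<open>Unlike the vanishing of the outer packing sum, this is trivially stable under countable unions;
  the arbitrarily small loss in the exponent is harmless for the entropy.\<close>

definition packing_sigma_finite :: "real \<Rightarrow> real \<Rightarrow> 'a set \<Rightarrow> bool" where
  "packing_sigma_finite e s A \<longleftrightarrow>
     (\<exists>\<W>. countable \<W> \<and> A \<subseteq> \<Union>\<W> \<and> (\<forall>W\<in>\<W>. W \<subseteq> M \<and> packing_pre_inf X T e s W < \<infinity>))"

lemma packing_sigma_finite_UN:
  assumes "countable I" "\<And>i. i \<in> I \<Longrightarrow> packing_sigma_finite e s (A i)"
  shows "packing_sigma_finite e s (\<Union>i\<in>I. A i)"
proof -
  have "\<forall>i\<in>I. \<exists>\<W>. countable \<W> \<and> A i \<subseteq> \<Union>\<W> \<and> (\<forall>W\<in>\<W>. W \<subseteq> M \<and> packing_pre_inf X T e s W < \<infinity>)"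
    using assms(2) by (simp add: packing_sigma_finite_def)
  from bchoice[OF this] obtain \<W> where \<W>: "\<And>i. i \<in> I \<Longrightarrow> countable (\<W> i)"
    "\<And>i. i \<in> I \<Longrightarrow> A i \<subseteq> \<Union>(\<W> i)"
    "\<And>i W. i \<in> I \<Longrightarrow> W \<in> \<W> i \<Longrightarrow> W \<subseteq> M \<and> packing_pre_inf X T e s W < \<infinity>" by metis
  have "countable (\<Union>i\<in>I. \<W> i)"
    using \<W>(1) assms(1) by (intro countable_UN) auto
  moreover have "(\<Union>i\<in>I. A i) \<subseteq> \<Union>(\<Union>i\<in>I. \<W> i)"
    using \<W>(2) by blast
  moreover have "\<forall>W\<in>(\<Union>i\<in>I. \<W> i). W \<subseteq> M \<and> packing_pre_inf X T e s W < \<infinity>"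
    using \<W>(3) by blast
  ultimately show ?thesis
    unfolding packing_sigma_finite_def by metis
qed

lemma packing_sigma_finite_Un:
  "packing_sigma_finite e s A \<Longrightarrow> packing_sigma_finite e s A' \<Longrightarrow> packing_sigma_finite e s (A \<union> A')"
  using packing_sigma_finite_UN[of "{A, A'}" e s id] by auto

lemma packing_sigma_finite_subset:
  "packing_sigma_finite e s A \<Longrightarrow> A' \<subseteq> A \<Longrightarrow> packing_sigma_finite e s A'"
  unfolding packing_sigma_finite_def by blast

text \<open>Here the loss in the exponent is spent: each covering set has a finite sum at
  \<open>s\<close>, hence sum 0 at \<open>t\<close>.\<close>

lemma packing_outer_eq_0_if_sigma_finite:
  assumes "packing_sigma_finite e s Z" "s < t"
  shows "packing_outer X T e t Z = 0"
proof -
  obtain \<W> where \<W>: "countable \<W>" "Z \<subseteq> \<Union>\<W>" "\<And>W. W \<in> \<W> \<Longrightarrow> W \<subseteq> M \<and> packing_pre_inf X T e s W < \<infinity>"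
    using assms(1) unfolding packing_sigma_finite_def by auto
  \<comment> \<open>The empty set has packing sum 0; inserting it makes the family non-empty, so
    that it is the range of a sequence.\<close>
  define W where "W = from_nat_into (insert {} \<W>)"
  have W: "range W = insert {} \<W>"
    unfolding W_def using \<W>(1) by (intro range_from_nat_into) auto
  have W_in: "W i \<in> insert {} \<W>" for i
    using W by blast
  have "packing_pre_inf X T e t (W i) = 0" for i
  proof (cases "W i = {}")
    case False
    then have "W i \<in> \<W>"
      using W_in[of i] by blast
    then show ?thesis
      using \<W>(3) packing_pre_inf_exponent[OF assms(2)] by blast
  qed (simp add: packing_pre_inf_empty)
  then have "(\<Sum>i. packing_pre_inf X T e t (W i)) = 0" by simp
  moreover have "\<forall>i. W i \<subseteq> M"
    using W_in \<W>(3) by (metis empty_subsetI insert_iff)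
  moreover have "Z \<subseteq> (\<Union>i. W i)"
    using W \<W>(2) by auto
  ultimately have "packing_outer X T e t Z \<le> 0"
    unfolding packing_outer_def by (intro Inf_lower) (auto intro!: exI[of _ W])
  then show ?thesis by simp
qed

text \<open>A Lindelof argument shows that the part \<open>H\<close> of \<open>K\<close> near whose
  points \<open>K\<close> is sigma-finite is itself sigma-finite. So \<open>K - H\<close> is
  non-empty, and a sigma-finite local piece of it would stay so after adding \<open>H\<close>,
  putting its centre into \<open>H\<close>.\<close>

lemma packing_sigma_finite_kernel:
  assumes K: "K \<subseteq> M" and nK: "\<not> packing_sigma_finite e s K"
  shows "\<exists>Z. Z \<subseteq> K \<and> Z \<noteq> {} \<and>
    (\<forall>x\<in>Z. \<forall>r>0. \<not> packing_sigma_finite e s (Z \<inter> mball_of (X 0) x r))"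
proof -
  define H where "H = {x \<in> K. \<exists>r>0. packing_sigma_finite e s (K \<inter> mball_of (X 0) x r)}"
  obtain Q where Q: "countable Q" "Q \<subseteq> M" "\<And>x r. x \<in> M \<Longrightarrow> r > 0 \<Longrightarrow> \<exists>q\<in>Q. d q x < r"
    using ex_countable_dense by blast
  \<comment> \<open>These indices name the countably many balls with centre in \<open>Q\<close> and
    radius \<open>1 / real (Suc k)\<close> that may be used to cover \<open>H\<close>.\<close>
  define I where "I = {(q, k::nat). q \<in> Q \<and>
      packing_sigma_finite e s (K \<inter> mball_of (X 0) q (1 / real (Suc k)))}"
  have "countable I"
    by (rule countable_subset[of _ "Q \<times> UNIV"]) (auto simp: I_def Q(1))
  then have "packing_sigma_finite e s (\<Union>(q,k)\<in>I. K \<inter> mball_of (X 0) q (1 / real (Suc k)))"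
    by (rule packing_sigma_finite_UN) (auto simp: I_def)
  moreover have "H \<subseteq> (\<Union>(q,k)\<in>I. K \<inter> mball_of (X 0) q (1 / real (Suc k)))"
  proof
    fix x assume "x \<in> H"
    then obtain r where r: "x \<in> K" "r > 0" "packing_sigma_finite e s (K \<inter> mball_of (X 0) x r)"
      unfolding H_def by blast
    \<comment> \<open>With radius below \<open>r / 2\<close>, a ball that contains \<open>x\<close>
      lies inside the ball of radius \<open>r\<close> about \<open>x\<close>.\<close>
    obtain k where k: "1 / real (Suc k) < r / 2"
      using nat_approx_posE[of "r/2"] \<open>r > 0\<close> by auto
    obtain q where q: "q \<in> Q" "d q x < 1 / real (Suc k)"
      using Q(3)[of x "1 / real (Suc k)"] r(1) K by auto
    have "K \<inter> mball_of (X 0) q (1 / real (Suc k)) \<subseteq> K \<inter> mball_of (X 0) x r"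
    proof clarsimp
      fix y assume y: "y \<in> K" "q \<in> M" "y \<in> M" "d q y < 1 / (1 + real k)"
      have "d x y \<le> d x q + d q y"
        using y r(1) K by (intro mdist_triangle) auto
      then show "x \<in> M \<and> d x y < r"
        using y k q r(1) K by (auto simp: mdist_commute[of _ x q])
    qed
    then have "(q, k) \<in> I"
      using packing_sigma_finite_subset[OF r(3)] q(1) by (auto simp: I_def)
    moreover have "x \<in> K \<inter> mball_of (X 0) q (1 / real (Suc k))"
      using q r(1) K Q(2) by auto
    ultimately show "x \<in> (\<Union>(q,k)\<in>I. K \<inter> mball_of (X 0) q (1 / real (Suc k)))"
      by blast
  qed
  ultimately have H: "packing_sigma_finite e s H"
    by (rule packing_sigma_finite_subset)
  have *: "\<not> packing_sigma_finite e s ((K - H) \<inter> mball_of (X 0) x r)" if "x \<in> K - H" "r > 0" for x r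
  proof
    assume "packing_sigma_finite e s ((K - H) \<inter> mball_of (X 0) x r)"
    then have "packing_sigma_finite e s ((K - H) \<inter> mball_of (X 0) x r \<union> H)"
      using H by (rule packing_sigma_finite_Un)
    then have "packing_sigma_finite e s (K \<inter> mball_of (X 0) x r)"
      by (rule packing_sigma_finite_subset) blast
    with that show False
      unfolding H_def by blast
  qed
  have "K - H \<noteq> {}"
    using H nK packing_sigma_finite_subset by blast
  with * show ?thesis
    by (intro exI[of _ "K - H"]) blast
qed

text \<open>Covering \<open>Z\<close> by itself shows that its packing sums are infinite. Disjoint
  closed balls do not contain each other's centres, which gives the separation.\<close>

lemma ex_large_finite_packing:
  assumes "\<not> packing_sigma_finite e s Z" "Z \<subseteq> M" "e \<ge> 0"
  shows "\<exists>E m. finite E \<and> E \<subseteq> Z \<and> (\<forall>x\<in>E. N \<le> m x) \<and>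
     (\<forall>x\<in>E. \<forall>y\<in>E. x \<noteq> y \<longrightarrow> e < D (m x) x y) \<and> c < (\<Sum>x\<in>E. exp (- real (m x) * s))"
proof -
  have "packing_pre_inf X T e s Z = \<infinity>"
  proof (rule ccontr)
    assume "\<not> ?thesis"
    with assms(2) have "packing_sigma_finite e s Z"
      unfolding packing_sigma_finite_def by (intro exI[of _ "{Z}"]) (auto simp: less_top)
    with assms(1) show False by simp
  qed
  \<comment> \<open>\<open>Suc N\<close> makes all orders positive, so that each closed ball
    contains its centre.\<close>
  then have "packing_pre X T (Suc N) e s Z = \<infinity>"
    using INF_lower[of "Suc N" UNIV "\<lambda>N. packing_pre X T N e s Z"]
    by (simp add: packing_pre_inf_eq_INF top_unique)
  then have "ennreal c < packing_pre X T (Suc N) e s Z" by simp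
  then obtain I n x where I: "finite I" "is_packing X T (Suc N) e Z I n x"
      "ennreal c < ennreal (\<Sum>i\<in>I. exp (- real (n i) * s))"
    unfolding packing_pre_finite less_Sup_iff by blast
  have xn: "x i \<in> Z" "Suc N \<le> n i" if "i \<in> I" for i
    using I(2) that by (auto simp: is_packing_def)
  have sep: "e < D (n i) (x i) (x j)" if ij: "i \<in> I" "j \<in> I" "i \<noteq> j" for i j
  proof -
    have "CB (n i) (x i) e \<inter> CB (n j) (x j) e = {}"
      using I(2) that by (auto simp: is_packing_def disjoint_family_on_def)
    moreover have "x j \<in> CB (n j) (x j) e"
      using xn[OF ij(2)] assms by (intro centre_in_bowen_cball) auto
    ultimately have "x j \<notin> CB (n i) (x i) e"
      by blast
    then show ?thesis
      using xn[OF ij(2)] assms(2) by (auto simp: bowen_cball_def)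
  qed
  \<comment> \<open>Two indices with one centre would give a self-distance above \<open>e\<close>.
    Hence the order can be made a function \<open>m\<close> of the point instead of the
    index.\<close>
  have inj: "inj_on x I"
  proof (rule inj_onI, rule ccontr)
    fix i j assume ij: "i \<in> I" "j \<in> I" "x i = x j" "i \<noteq> j"
    from sep[OF ij(1,2,4)] have "e < D (n i) (x i) (x i)"
      using ij(3) by simp
    moreover have "D (n i) (x i) (x i) = 0"
      using xn[OF ij(1)] assms(2) by (intro bowen_dist_self) auto
    ultimately show False
      using assms(3) by simp
  qed
  define m where "m = n \<circ> inv_into I x"
  have m: "m (x i) = n i" if "i \<in> I" for i
    using that inj by (simp add: m_def inv_into_f_f)
  have "(\<Sum>y\<in>x`I. exp (- real (m y) * s)) = (\<Sum>i\<in>I. exp (- real (n i) * s))"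
    using inj by (simp add: sum.reindex m)
  moreover have "c < (\<Sum>i\<in>I. exp (- real (n i) * s))"
  proof (rule ccontr)
    assume "\<not> ?thesis"
    then show False
      using I(3) ennreal_leI[of "\<Sum>i\<in>I. exp (- real (n i) * s)" c] by (simp add: not_less)
  qed
  ultimately have "c < (\<Sum>y\<in>x`I. exp (- real (m y) * s))"
    by simp
  moreover have "\<forall>y\<in>x`I. N \<le> m y" "x ` I \<subseteq> Z"
    using xn by (auto simp: m Suc_leD)
  moreover have "\<forall>y\<in>x`I. \<forall>z\<in>x`I. y \<noteq> z \<longrightarrow> e < D (m y) y z"
    using sep by (auto simp: m)
  ultimately show ?thesis
    using I(1) by (intro exI[of _ "x ` I"] exI[of _ m]) blast
qed

subsection \<open>Upper bound for the measure-theoretic entropy\<close>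

text \<open>Every ball contains a point of a countable dense set, and disjointness makes the choice
  of that point injective.\<close>

lemma disjoint_bowen_cballs_imp_countable:
  assumes "C \<subseteq> M" "e > 0" "\<And>x. x \<in> C \<Longrightarrow> \<nu> x > 0"
    and "disjoint_family_on (\<lambda>x. CB (\<nu> x) x e) C"
  shows "countable C"
proof -
  obtain Q where Q: "countable Q" "Q \<subseteq> M" "\<And>x r. x \<in> M \<Longrightarrow> r > 0 \<Longrightarrow> \<exists>q\<in>Q. d q x < r"
    using ex_countable_dense by blast
  have "\<exists>q\<in>Q. q \<in> CB (\<nu> x) x e" if x: "x \<in> C" for x
  proof -
    have xM: "x \<in> M" and nx: "\<nu> x > 0"
      using x assms by auto
    obtain r where r: "r > 0" "\<forall>y\<in>M. d x y \<le> r \<longrightarrow> D (\<nu> x) x y < e"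
      using bowen_dist_small[OF nx xM assms(2)] by blast
    obtain q where q: "q \<in> Q" "d q x < r"
      using Q(3)[OF xM r(1)] by blast
    then have "q \<in> M" "d x q \<le> r"
      using Q(2) by (auto simp: mdist_commute)
    then have "q \<in> CB (\<nu> x) x e"
      using r(2) by (auto simp: bowen_cball_def intro: less_imp_le)
    with q show ?thesis by blast
  qed
  then obtain q where q: "\<And>x. x \<in> C \<Longrightarrow> q x \<in> Q \<and> q x \<in> CB (\<nu> x) x e"
    by metis
  have "inj_on q C"
  proof (rule inj_onI, rule ccontr)
    fix x y assume "x \<in> C" "y \<in> C" "q x = q y" "x \<noteq> y"
    then show False
      using assms(4) q[of x] q[of y] by (auto simp: disjoint_family_on_def)
  qed
  moreover have "countable (q ` C)"
    using q Q(1) by (meson countable_subset image_subsetI)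
  ultimately show ?thesis
    using countable_image_inj_on by blast
qed

text \<open>A rejected centre \<open>x\<close> meets a selected ball about some \<open>y\<close>
  with \<open>\<nu> y \<le> \<nu> x\<close>. Since Bowen distances grow with the order,
  \<open>x\<close> and \<open>y\<close> are at distance at most \<open>2 * e\<close> in the smaller
  order \<open>\<nu> y\<close>, hence strictly below \<open>3 * e\<close>.\<close>

lemma bowen_vitali_covering:
  assumes F: "F \<subseteq> M" and e: "e > 0" and \<nu>: "\<And>x. x \<in> F \<Longrightarrow> \<nu> x > (0::nat)"
  shows "\<exists>C\<subseteq>F. countable C \<and> disjoint_family_on (\<lambda>x. CB (\<nu> x) x e) C \<and>
    F \<subseteq> (\<Union>x\<in>C. B (\<nu> x) x (3 * e))"
proof -
  obtain r :: "'a rel" where r: "Well_order r" "Field r = UNIV"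
    using Zorn.well_ordering[where ?'a = 'a] by auto
  \<comment> \<open>P selects greedily along a well-order that lists the balls by increasing order\<close>
  define R where "R = inv_image (less_than <*lex*> (r - Id)) (\<lambda>x. (\<nu> x, x))"
  have "wf R"
    unfolding R_def using r(1) by (intro wf_inv_image wf_lex_prod) (simp_all add: well_order_on_def)
  \<comment> \<open>Equal orders are separated by the well-order \<open>r\<close>. Totality matters
    for disjointness: of two selected centres, one was considered first and excludes the other if
    their balls meet.\<close>
  have R_total: "(x, y) \<in> R \<or> (y, x) \<in> R" if "x \<noteq> y" for x y
  proof -
    have "(x, y) \<in> r - Id \<or> (y, x) \<in> r - Id"
      using r that by (auto simp: well_order_on_def linear_order_on_def total_on_def)
    then show ?thesis
      by (auto simp: R_def)
  qed
  have R_le: "\<nu> y \<le> \<nu> x" if "(y, x) \<in> R" for x y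
    using that by (auto simp: R_def)
  define meet where "meet x y \<longleftrightarrow> CB (\<nu> y) y e \<inter> CB (\<nu> x) x e \<noteq> {}" for x y
  define G where "G f x \<longleftrightarrow> x \<in> F \<and> (\<forall>y. (y, x) \<in> R \<and> f y \<longrightarrow> \<not> meet x y)" for f x
  define P where "P = wfrec R G"
  have P: "P x \<longleftrightarrow> x \<in> F \<and> (\<forall>y. (y, x) \<in> R \<and> P y \<longrightarrow> \<not> meet x y)" for x
  proof -
    have "P x \<longleftrightarrow> G (cut P R x) x"
      unfolding P_def by (subst wfrec[OF \<open>wf R\<close>]) (rule refl)
    also have "\<dots> \<longleftrightarrow> x \<in> F \<and> (\<forall>y. (y, x) \<in> R \<and> P y \<longrightarrow> \<not> meet x y)"
      unfolding G_def by (metis cut_apply)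
    finally show ?thesis .
  qed
  define C where "C = {x. P x}"
  have CF: "C \<subseteq> F"
    unfolding C_def using P by blast
  have meet_sym: "meet x y \<longleftrightarrow> meet y x" for x y
    by (auto simp: meet_def)
  have disj: "disjoint_family_on (\<lambda>x. CB (\<nu> x) x e) C"
    unfolding disjoint_family_on_def
  proof (intro ballI impI)
    fix x y assume "x \<in> C" "y \<in> C" "x \<noteq> y"
    then have "P x" "P y" "(x, y) \<in> R \<or> (y, x) \<in> R"
      using R_total by (auto simp: C_def)
    then have "\<not> meet x y"
      using P[of x] P[of y] meet_sym[of x y] by metis
    then show "CB (\<nu> x) x e \<inter> CB (\<nu> y) y e = {}"
      by (auto simp: meet_def)
  qed
  have cover: "F \<subseteq> (\<Union>x\<in>C. B (\<nu> x) x (3 * e))"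
  proof
    fix x assume x: "x \<in> F"
    show "x \<in> (\<Union>x\<in>C. B (\<nu> x) x (3 * e))"
    proof (cases "x \<in> C")
      case True
      then show ?thesis
        using centre_in_bowen_ball[OF \<nu>[OF x], of x "3 * e"] x F e by auto
    next
      case False
      then obtain y where y: "(y, x) \<in> R" "y \<in> C" "meet x y"
        using P[of x] x by (auto simp: C_def)
      then obtain z where z: "z \<in> M" "D (\<nu> y) y z \<le> e" "D (\<nu> x) x z \<le> e"
        by (auto simp: meet_def bowen_cball_def)
      have "y \<in> F" using y(2) CF by blast
      have "D (\<nu> y) y x \<le> D (\<nu> y) y z + D (\<nu> y) z x"
        using \<open>y \<in> F\<close> x F z(1) \<nu> by (intro bowen_dist_triangle) auto
      also have "D (\<nu> y) z x \<le> D (\<nu> x) z x"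
        using \<nu>[OF \<open>y \<in> F\<close>] R_le[OF y(1)] by (rule bowen_dist_mono)
      finally have "D (\<nu> y) y x < 3 * e"
        using z e bowen_dist_commute[of "\<nu> x" z x] by simp
      then have "x \<in> B (\<nu> y) y (3 * e)"
        using x F by (auto simp: bowen_ball_def)
      with y(2) show ?thesis by blast
    qed
  qed
  have "countable C"
    by (rule disjoint_bowen_cballs_imp_countable[OF _ e _ disj]) (use CF F \<nu> in auto)
  with CF disj cover show ?thesis
    by blast
qed

lemma bowen_ball_in_sets:
  assumes "\<mu> \<in> borel_probs (X 0)" "n > 0" "x \<in> M"
  shows "B n x e \<in> sets \<mu>"
  using openin_bowen_ball[OF assms(2,3), of e] assms(1) by (auto simp: borel_probs_def)

text \<open>Mass distribution principle: the balls of radius \<open>3 * e\<close> about a Vitali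
  subfamily cover \<open>F\<close> and have small mass, while those of radius \<open>e\<close> form
  a packing. The outer measure is used because \<open>F\<close> may fail to be measurable.\<close>

lemma outer_measure_le_packing_pre:
  assumes \<mu>: "\<mu> \<in> borel_probs (X 0)" and "F \<subseteq> W" "W \<subseteq> M" "e > 0"
    and dim: "\<And>x. x \<in> F \<Longrightarrow> \<exists>n\<ge>Suc N. measure \<mu> (B n x (3 * e)) \<le> exp (- real n * s)"
  shows "outer_measure_of \<mu> F \<le> packing_pre X T N e s W"
proof -
  interpret prob_space \<mu>
    using \<mu> by (simp add: borel_probs_def)
  obtain \<nu> where \<nu>: "\<And>x. x \<in> F \<Longrightarrow> \<nu> x \<ge> Suc N \<and> measure \<mu> (B (\<nu> x) x (3 * e)) \<le> exp (- real (\<nu> x) * s)"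
    using dim by metis
  then have \<nu>0: "\<nu> x > 0" if "x \<in> F" for x
    using that by fastforce
  obtain C where C: "C \<subseteq> F" "countable C" "disjoint_family_on (\<lambda>x. CB (\<nu> x) x e) C"
    "F \<subseteq> (\<Union>x\<in>C. B (\<nu> x) x (3 * e))"
    using bowen_vitali_covering[OF subset_trans[OF assms(2,3)] assms(4), of \<nu>] \<nu>0
    by (elim meta_impE exE conjE) (assumption | rule that)+
  \<comment> \<open>\<open>is_packing\<close> wants indices in the naturals, so the countable set
    \<open>C\<close> is enumerated.\<close>
  define I where "I = to_nat_on C ` C"
  define x where "x = from_nat_into C"
  have xI: "x i \<in> C" if "i \<in> I" for i
    using that C(2) unfolding I_def x_def by force
  have inj: "inj_on x I"
    using C(2) by (auto simp: I_def x_def inj_on_def)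
  have xC: "x ` I = C"
    using C(2) by (auto simp: I_def x_def image_image)
  have pack: "is_packing X T N e W I (\<nu> \<circ> x) x"
    unfolding is_packing_def
  proof (intro conjI ballI)
    fix i assume "i \<in> I"
    then have "x i \<in> F"
      using xI C(1) by blast
    then show "x i \<in> W" "N \<le> (\<nu> \<circ> x) i"
      using assms(2) \<nu>[of "x i"] by auto
  next
    show "disjoint_family_on (\<lambda>i. CB ((\<nu> \<circ> x) i) (x i) e) I"
      using C(3) xI inj unfolding disjoint_family_on_def by (auto simp: inj_on_eq_iff)
  qed
  define A where "A i = (if i \<in> I then B (\<nu> (x i)) (x i) (3 * e) else {})" for i
  have A: "A i \<in> sets \<mu>" for i
    using xI[of i] C(1) assms(2,3) \<nu>0[of "x i"] by (auto simp: A_def intro!: bowen_ball_in_sets[OF \<mu>])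
  have eA: "emeasure \<mu> (A i) \<le> (if i \<in> I then ennreal (exp (- real (\<nu> (x i)) * s)) else 0)" for i
    using xI[of i] C(1) \<nu>[of "x i"] by (auto simp: A_def emeasure_eq_measure intro!: ennreal_leI)
  have "F \<subseteq> (\<Union>i. A i)"
    using C(4) unfolding xC[symmetric] by (fastforce simp: A_def)
  then have "outer_measure_of \<mu> F \<le> emeasure \<mu> (\<Union>i. A i)"
    using A outer_measure_of_mono[of F "\<Union>i. A i" \<mu>] by auto
  also have "\<dots> \<le> (\<Sum>i. emeasure \<mu> (A i))"
    using A by (intro emeasure_subadditive_countably) auto
  also have "\<dots> \<le> (\<Sum>i. if i \<in> I then ennreal (exp (- real (\<nu> (x i)) * s)) else 0)"
    using eA by (intro suminf_le) auto
  also have "\<dots> \<le> packing_pre X T N e s W"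
    unfolding suminf_eq_SUP
  proof (rule SUP_least)
    fix k
    have "(\<Sum>i<k. if i \<in> I then ennreal (exp (- real (\<nu> (x i)) * s)) else 0)
       = (\<Sum>i\<in>{..<k} \<inter> I. ennreal (exp (- real (\<nu> (x i)) * s)))"
      by (rule sum.inter_restrict[symmetric]) simp
    also have "\<dots> = ennreal (\<Sum>i\<in>{..<k} \<inter> I. exp (- real ((\<nu> \<circ> x) i) * s))"
      unfolding comp_def by (rule sum_ennreal) simp
    also have "\<dots> \<le> packing_pre X T N e s W"
      unfolding packing_pre_finite using is_packing_subset[OF pack, of "{..<k} \<inter> I"]
      by (intro Sup_upper) blast
    finally show "(\<Sum>i<k. if i \<in> I then ennreal (exp (- real (\<nu> (x i)) * s)) else 0)
       \<le> packing_pre X T N e s W" .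
  qed
  finally show ?thesis .
qed

abbreviation local_rate :: "'a measure \<Rightarrow> 'a \<Rightarrow> real \<Rightarrow> ereal" where
  "local_rate \<mu> x e \<equiv> limsup (\<lambda>n. - elog (measure \<mu> (B n x e)) / ereal (real n))"

text \<open>The mass distribution principle bounds the outer measure of each piece
  \<open>E \<inter> W i\<close> of a cover by the packing sum of \<open>W i\<close>; summing and
  taking the infimum over covers gives 0.\<close>

lemma null_set_if_packing_outer_eq_0:
  assumes \<mu>: "\<mu> \<in> borel_probs (X 0)" and "Z \<subseteq> M" "e > 0" "packing_outer X T e s Z = 0"
  shows "\<exists>A\<in>null_sets \<mu>. {x \<in> Z. ereal s < local_rate \<mu> x (3 * e)} \<subseteq> A"
proof -
  define E where "E = {x \<in> Z. ereal s < local_rate \<mu> x (3 * e)}"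
  have sp: "space \<mu> = M"
    using \<mu> by (simp add: borel_probs_def)
  \<comment> \<open>The strict lower bound on the limsup makes the rate exceed \<open>s\<close> at
    arbitrarily large orders.\<close>
  have dim: "\<exists>n\<ge>Suc N. measure \<mu> (B n x (3 * e)) \<le> exp (- real n * s)" if "x \<in> E" for x N
  proof (rule ccontr)
    assume neg: "\<not> ?thesis"
    have "- elog (measure \<mu> (B n x (3 * e))) / ereal (real n) \<le> ereal s" if "n \<ge> Suc N" for n
      using neg that less_minus_elog_divideD[of s "measure \<mu> (B n x (3 * e))" n] by force
    then have "local_rate \<mu> x (3 * e) \<le> ereal s"
      by (intro Limsup_bounded) (auto simp: eventually_sequentially intro!: exI[of _ "Suc N"])
    with that show False
      by (simp add: E_def flip: not_le)
  qed
  have "outer_measure_of \<mu> E \<le> packing_outer X T e s Z"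
    unfolding packing_outer_def
  proof (rule Inf_greatest, clarify)
    fix W :: "nat \<Rightarrow> 'a set" assume W: "\<forall>i. W i \<subseteq> M" "Z \<subseteq> (\<Union>i. W i)"
    \<comment> \<open>Measurable hulls of equal measure reduce countable subadditivity of the outer
      measure to that of \<open>\<mu>\<close>.\<close>
    have "\<exists>A\<in>sets \<mu>. E \<inter> W i \<subseteq> A \<and> outer_measure_of \<mu> (E \<inter> W i) = emeasure \<mu> A" for i
      using W(1) sp by (intro outer_measure_of_attain) auto
    then obtain A where A: "\<And>i. A i \<in> sets \<mu>" "\<And>i. E \<inter> W i \<subseteq> A i"
        "\<And>i. outer_measure_of \<mu> (E \<inter> W i) = emeasure \<mu> (A i)"
      by metis
    have "outer_measure_of \<mu> E \<le> outer_measure_of \<mu> (\<Union>i. A i)"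
    proof (rule outer_measure_of_mono, rule subsetI)
      fix x assume "x \<in> E"
      moreover from this obtain i where "x \<in> W i"
        using W(2) by (auto simp: E_def)
      ultimately show "x \<in> (\<Union>i. A i)"
        using A(2)[of i] by blast
    qed
    also have "\<dots> \<le> (\<Sum>i. emeasure \<mu> (A i))"
      using A(1) emeasure_subadditive_countably[of A \<mu>] by auto
    also have "\<dots> \<le> (\<Sum>i. packing_pre_inf X T e s (W i))"
    proof (intro suminf_le)
      show "emeasure \<mu> (A i) \<le> packing_pre_inf X T e s (W i)" for i
        unfolding A(3)[symmetric] packing_pre_inf_eq_INF
        using W(1) assms(3) dim
        by (intro INF_greatest outer_measure_le_packing_pre[OF \<mu>]) auto
    qed auto
    finally show "outer_measure_of \<mu> E \<le> (\<Sum>i. packing_pre_inf X T e s (W i))" .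
  qed
  then have "outer_measure_of \<mu> E = 0"
    using assms(4) by simp
  moreover have "\<exists>A\<in>sets \<mu>. E \<subseteq> A \<and> outer_measure_of \<mu> E = emeasure \<mu> A"
    using assms(2) sp by (intro outer_measure_of_attain) (auto simp: E_def)
  ultimately show ?thesis
    unfolding E_def[symmetric] by (metis null_setsI)
qed

section \<open>Local rates as the scale shrinks, and the upper bound for the integrated
  entropy\<close>

lemma local_rate_antimono:
  assumes \<mu>: "\<mu> \<in> borel_probs (X 0)" and "x \<in> M" "a \<le> b"
  shows "local_rate \<mu> x b \<le> local_rate \<mu> x a"
proof (rule Limsup_mono)
  interpret prob_space \<mu>
    using \<mu> by (simp add: borel_probs_def)
  have "- elog (measure \<mu> (B n x b)) / ereal (real n) \<le> - elog (measure \<mu> (B n x a)) / ereal (real n)"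
    if "n \<ge> 1" for n
  proof (intro ereal_divide_right_mono)
    have "measure \<mu> (B n x a) \<le> measure \<mu> (B n x b)"
      using bowen_ball_in_sets[OF \<mu>] assms that
      by (intro finite_measure_mono) (auto simp: bowen_ball_def)
    then show "- elog (measure \<mu> (B n x b)) \<le> - elog (measure \<mu> (B n x a))"
      by (simp add: elog_mono)
  qed (use that in auto)
  then show "\<forall>\<^sub>F n in sequentially. - elog (measure \<mu> (B n x b)) / ereal (real n)
      \<le> - elog (measure \<mu> (B n x a)) / ereal (real n)"
    by (auto simp: eventually_sequentially)
qed

lemma local_upper_entropy_eq_SUP:
  assumes "\<mu> \<in> borel_probs (X 0)" "x \<in> M"
  shows "local_upper_entropy X T \<mu> x = (SUP e\<in>{0<..}. local_rate \<mu> x e)"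
  unfolding local_upper_entropy_def
  using local_rate_antimono[OF assms] by (rule Lim_at_right_0_antitone)

text \<open>Used to exclude a negative upper bound, which \<open>e2ennreal\<close> would truncate to
  0.\<close>

lemma local_upper_entropy_nonneg:
  assumes \<mu>: "\<mu> \<in> borel_probs (X 0)" and "x \<in> M"
  shows "0 \<le> local_upper_entropy X T \<mu> x"
proof -
  interpret prob_space \<mu>
    using \<mu> by (simp add: borel_probs_def)
  have "0 \<le> - elog (measure \<mu> (B n x 1)) / ereal (real n)" if "n \<ge> 1" for n
  proof -
    have "0 / ereal (real n) \<le> - elog (measure \<mu> (B n x 1)) / ereal (real n)"
      using that elog_le_0[of "measure \<mu> (B n x 1)"] by (intro ereal_divide_right_mono) auto
    then show ?thesis by simp
  qed
  then have "0 \<le> local_rate \<mu> x 1"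
    by (intro le_Limsup) (auto simp: eventually_sequentially)
  also have "\<dots> \<le> local_upper_entropy X T \<mu> x"
    unfolding local_upper_entropy_eq_SUP[OF assms] by (rule SUP_upper) simp
  finally show ?thesis .
qed

text \<open>Above the packing entropy the outer sums vanish at every scale, so almost everywhere on
  \<open>K\<close> the local rates, and hence the local entropy, are at most \<open>t\<close>; then
  integrate.\<close>

theorem upper_entropy_le_packing_entropy:
  assumes \<mu>: "\<mu> \<in> borel_probs (X 0)" and K: "K \<subseteq> M" "measure \<mu> K = 1"
  shows "upper_entropy X T \<mu> \<le> packing_entropy X T K"
proof (rule dense_ge)
  interpret prob_space \<mu>
    using \<mu> by (simp add: borel_probs_def)
  have sp: "space \<mu> = M"
    using \<mu> by (simp add: borel_probs_def)
  fix s assume s: "packing_entropy X T K < s"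
  show "upper_entropy X T \<mu> \<le> s"
  proof (cases s)
    case (real t)
    have outer: "packing_outer X T e t K = 0" if "e > 0" for e
    proof -
      have "Inf {ereal s | s. packing_outer X T e s K = 0} \<le> packing_entropy X T K"
        unfolding packing_entropy_eq_SUP using that by (intro SUP_upper) simp
      then obtain t' where "packing_outer X T e t' K = 0" "t' < t"
        using s real by (auto simp: Inf_less_iff dest!: le_less_trans)
      then show ?thesis
        using packing_outer_mono[of e e t' t K] by simp
    qed
    \<comment> \<open>Only countably many scales are treated, so the null sets can be united;
      monotonicity of \<open>local_rate\<close> recovers all scales.\<close>
    have "AE x in \<mu>. x \<in> K \<longrightarrow> local_rate \<mu> x (1 / real (Suc k)) \<le> ereal t" for k
    proof -
      obtain A where A: "A \<in> null_sets \<mu>"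
        "{x \<in> K. ereal t < local_rate \<mu> x (3 * (1 / (3 * real (Suc k))))} \<subseteq> A"
        using null_set_if_packing_outer_eq_0[OF \<mu> K(1) _ outer, of "1 / (3 * real (Suc k))"] by auto
      have "3 * (1 / (3 * real (Suc k))) = 1 / real (Suc k)"
        by (simp add: field_simps)
      from A(2)[unfolded this] have "x \<in> K \<longrightarrow> local_rate \<mu> x (1 / real (Suc k)) \<le> ereal t" if "x \<notin> A" for x
        using that by (auto simp flip: not_less)
      then show ?thesis
        by (intro AE_I'[OF A(1)]) blast
    qed
    then have "AE x in \<mu>. \<forall>k. x \<in> K \<longrightarrow> local_rate \<mu> x (1 / real (Suc k)) \<le> ereal t"
      by (simp only: AE_all_countable) blast
    \<comment> \<open>Non-measurable sets get the value 0 from \<open>measure\<close>, so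
      \<open>measure \<mu> K = 1\<close> makes \<open>K\<close> measurable.\<close>
    moreover have "AE x in \<mu>. x \<in> K"
      using K(2) measure_notin_sets[of K \<mu>] by (intro AE_in_set_eq_1[THEN iffD2]) force+
    ultimately have ae: "AE x in \<mu>. local_upper_entropy X T \<mu> x \<le> ereal t \<and> 0 \<le> ereal t"
    proof eventually_elim
      case (elim x)
      have "local_rate \<mu> x e \<le> ereal t" if e: "e > 0" for e
      proof -
        obtain k where "1 / real (Suc k) < e"
          using nat_approx_posE[OF e] by blast
        then have "local_rate \<mu> x e \<le> local_rate \<mu> x (1 / real (Suc k))"
          using elim K(1) by (intro local_rate_antimono[OF \<mu>]) auto
        also have "\<dots> \<le> ereal t"
          using elim by blast
        finally show ?thesis .
      qed
      then have "local_upper_entropy X T \<mu> x \<le> ereal t"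
        using elim K(1) by (subst local_upper_entropy_eq_SUP[OF \<mu>]) (auto intro: SUP_least)
      moreover have "0 \<le> local_upper_entropy X T \<mu> x"
        using elim K(1) by (intro local_upper_entropy_nonneg[OF \<mu>]) auto
      ultimately show ?case
        using order_trans by blast
    qed
    \<comment> \<open>A property that holds almost everywhere for a probability measure cannot be
      false outright, so the constant clause of \<open>ae\<close> is true.\<close>
    have "t \<ge> 0"
    proof (rule ccontr)
      assume "\<not> t \<ge> 0"
      with ae have "AE x in \<mu>. False" by simp
      then show False by simp
    qed
    have "(\<integral>\<^sup>+ x. e2ennreal (local_upper_entropy X T \<mu> x) \<partial>\<mu>) \<le> (\<integral>\<^sup>+ x. e2ennreal (ereal t) \<partial>\<mu>)"
      using ae by (intro nn_integral_mono_AE) (auto elim!: eventually_mono intro: e2ennreal_mono simp del: e2ennreal_ereal)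
    also have "\<dots> = e2ennreal (ereal t)"
      by (simp add: emeasure_space_1)
    finally have "upper_entropy X T \<mu> \<le> enn2ereal (e2ennreal (ereal t))"
      unfolding upper_entropy_def by (simp only: less_eq_ennreal.rep_eq)
    also have "\<dots> = s"
      using \<open>t \<ge> 0\<close> real by (subst enn2ereal_e2ennreal) auto
    finally show ?thesis .
  next
    case MInf
    with s show ?thesis by simp
  qed simp
qed

subsection \<open>Construction of measures of large entropy\<close>

text \<open>Moving each endpoint by less than half the gap \<open>D (m x) x y - e\<close>, measured
  in the order \<open>m x\<close>, keeps the distance above \<open>e\<close>. There are finitely
  many pairs, so one radius serves all.\<close>

lemma ex_separating_radius:
  assumes E: "finite E" "E \<subseteq> M" and m: "\<And>x. x \<in> E \<Longrightarrow> 0 < m x"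
    and sep: "\<And>x y. x \<in> E \<Longrightarrow> y \<in> E \<Longrightarrow> x \<noteq> y \<Longrightarrow> e < D (m x) x y" and b: "0 < b"
  shows "\<exists>r>0. r \<le> b \<and> (\<forall>x\<in>E. \<forall>y\<in>E. x \<noteq> y \<longrightarrow>
    (\<forall>z\<in>M. \<forall>w\<in>M. d x z \<le> r \<longrightarrow> d y w \<le> r \<longrightarrow> e < D (m x) z w))"
proof -
  have "\<exists>r>0. \<forall>z\<in>M. \<forall>w\<in>M. d x z \<le> r \<longrightarrow> d y w \<le> r \<longrightarrow> e < D (m x) z w"
    if xy: "x \<in> E" "y \<in> E" "x \<noteq> y" for x y
  proof -
    define h where "h = (D (m x) x y - e) / 2"
    have h: "h > 0"
      using sep[OF xy] by (simp add: h_def)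
    have xM: "x \<in> M" "y \<in> M"
      using xy E(2) by auto
    obtain r1 where r1: "r1 > 0" "\<And>z. z \<in> M \<Longrightarrow> d x z \<le> r1 \<Longrightarrow> D (m x) x z < h"
      using bowen_dist_small[OF m[OF xy(1)] xM(1) h] by blast
    obtain r2 where r2: "r2 > 0" "\<And>z. z \<in> M \<Longrightarrow> d y z \<le> r2 \<Longrightarrow> D (m x) y z < h"
      using bowen_dist_small[OF m[OF xy(1)] xM(2) h] by blast
    have "e < D (m x) z w" if zw: "z \<in> M" "w \<in> M" "d x z \<le> min r1 r2" "d y w \<le> min r1 r2" for z w
    proof -
      have "D (m x) x y \<le> D (m x) x z + D (m x) z y"
        "D (m x) z y \<le> D (m x) z w + D (m x) w y"
        using zw xM m[OF xy(1)] by (auto intro!: bowen_dist_triangle)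
      moreover have "D (m x) x z < h" "D (m x) w y < h"
        using r1(2)[OF zw(1)] r2(2)[OF zw(2)] zw(3,4) by (auto simp: bowen_dist_commute[of _ w])
      ultimately show ?thesis
        by (simp add: h_def)
    qed
    then show ?thesis
      using r1(1) r2(1) by (intro exI[of _ "min r1 r2"]) auto
  qed
  then have "\<exists>r. \<forall>x\<in>E. \<forall>y\<in>E. x \<noteq> y \<longrightarrow> r x y > 0 \<and>
      (\<forall>z\<in>M. \<forall>w\<in>M. d x z \<le> r x y \<longrightarrow> d y w \<le> r x y \<longrightarrow> e < D (m x) z w)"
    by metis
  then obtain r where r: "\<And>x y. x \<in> E \<Longrightarrow> y \<in> E \<Longrightarrow> x \<noteq> y \<Longrightarrow> r x y > 0"
      "\<And>x y z w. x \<in> E \<Longrightarrow> y \<in> E \<Longrightarrow> x \<noteq> y \<Longrightarrow> z \<in> M \<Longrightarrow> w \<in> M \<Longrightarrow> d x z \<le> r x y \<Longrightarrow>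
        d y w \<le> r x y \<Longrightarrow> e < D (m x) z w"
    by blast
  define I where "I = {(x, y). x \<in> E \<and> y \<in> E \<and> x \<noteq> y}"
  have "finite I"
    by (rule finite_subset[of _ "E \<times> E"]) (auto simp: I_def E(1))
  \<comment> \<open>Inserting \<open>b\<close> enforces the bound and keeps the minimum meaningful
    when there are no pairs.\<close>
  define R where "R = Min (insert b (case_prod r ` I))"
  have "R > 0"
    unfolding R_def using \<open>finite I\<close> b r(1) by (subst Min_gr_iff) (auto simp: I_def)
  moreover have "R \<le> b"
    unfolding R_def using \<open>finite I\<close> by (intro Min_le) auto
  moreover have "R \<le> r x y" if "x \<in> E" "y \<in> E" "x \<noteq> y" for x y
    unfolding R_def using \<open>finite I\<close> that by (intro Min_le) (auto simp: I_def)
  ultimately show ?thesis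
    using r(2) by (intro exI[of _ R]) (meson order_trans)
qed

text \<open>The separation is required on entire closed balls of radius r, because the points of the limit
  set are only known to lie r-close to E. The fibres of f partition the unit interval.\<close>

fun stage :: "real \<Rightarrow> real \<Rightarrow> 'a set \<Rightarrow> nat \<Rightarrow>
    'a set \<times> ('a \<Rightarrow> nat) \<times> real \<times> (real \<Rightarrow> 'a) \<Rightarrow> bool" where
  "stage e s Z i (E, m, r, f) \<longleftrightarrow>
     finite E \<and> E \<subseteq> Z \<and> 0 < r \<and> (\<forall>x\<in>E. i < m x) \<and>
     (\<forall>x\<in>E. \<forall>y\<in>E. x \<noteq> y \<longrightarrow>
       (\<forall>z\<in>M. \<forall>w\<in>M. d x z \<le> r \<longrightarrow> d y w \<le> r \<longrightarrow> e < D (m x) z w)) \<and>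
     (\<forall>u. f u \<in> E) \<and>
     (\<forall>x\<in>E. {u. f u = x} \<in> sets borel \<and>
       measure unit_uniform {u. f u = x} \<le> exp (- real (m x) * s))"

text \<open>The two halves add up to \<open>r\<close>, so for each \<open>u\<close> the closed ball
  about \<open>f' u\<close> of radius \<open>r'\<close> lies in that about \<open>f u\<close> of
  radius \<open>r\<close>.\<close>

fun refines :: "'a set \<times> ('a \<Rightarrow> nat) \<times> real \<times> (real \<Rightarrow> 'a) \<Rightarrow>
    'a set \<times> ('a \<Rightarrow> nat) \<times> real \<times> (real \<Rightarrow> 'a) \<Rightarrow> bool" where
  "refines (E, m, r, f) (E', m', r', f') \<longleftrightarrow> r' \<le> r / 2 \<and> (\<forall>u. d (f u) (f' u) \<le> r / 2)"

text \<open>A packing of total weight above 1 has enough weight to partition the whole unit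
  interval.\<close>

lemma ex_stage_0:
  assumes Z: "Z \<subseteq> M" "\<not> packing_sigma_finite e s Z" and e: "e \<ge> 0"
  shows "\<exists>S. stage e s Z 0 S"
proof -
  obtain E m where E: "finite E" "E \<subseteq> Z" "\<forall>x\<in>E. 1 \<le> m x"
      "\<forall>x\<in>E. \<forall>y\<in>E. x \<noteq> y \<longrightarrow> e < D (m x) x y" "1 < (\<Sum>x\<in>E. exp (- real (m x) * s))"
    using ex_large_finite_packing[OF Z(2,1) e, of 1 1] by blast
  have "E \<subseteq> M"
    using E(2) Z(1) by blast
  obtain r where r: "r > 0" "\<forall>x\<in>E. \<forall>y\<in>E. x \<noteq> y \<longrightarrow>
       (\<forall>z\<in>M. \<forall>w\<in>M. d x z \<le> r \<longrightarrow> d y w \<le> r \<longrightarrow> e < D (m x) z w)"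
    using ex_separating_radius[OF E(1) \<open>E \<subseteq> M\<close>, of m e 1] E(3,4) by force
  have "E \<noteq> {}"
    using E(5) by auto
  have "\<exists>g. (\<forall>u\<in>UNIV. g u \<in> E) \<and> (\<forall>y\<in>E. {u\<in>UNIV. g u = y} \<in> sets borel \<and>
      measure unit_uniform {u\<in>UNIV. g u = y} \<le> exp (- real (m y) * s))"
  proof (rule unit_uniform_ex_partition[OF E(1) \<open>E \<noteq> {}\<close>])
    show "measure unit_uniform UNIV \<le> (\<Sum>y\<in>E. exp (- real (m y) * s))"
      using E(5) prob_space.prob_space[OF prob_space_unit_uniform] by simp
  qed auto
  then obtain f where "\<forall>u. f u \<in> E" "\<forall>y\<in>E. {u. f u = y} \<in> sets borel \<and>
      measure unit_uniform {u. f u = y} \<le> exp (- real (m y) * s)"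
    by auto
  with E r have "stage e s Z 0 (E, m, r, f)"
    by (simp add: Suc_le_eq)
  then show ?thesis ..
qed

text \<open>Each \<open>x\<close> is replaced by a finite packing \<open>F x\<close> near it whose
  weight exceeds the bound on the piece of \<open>x\<close>; that piece is then divided among
  \<open>F x\<close>.\<close>

lemma ex_stage_Suc:
  assumes Z: "Z \<subseteq> M" "\<And>x r. x \<in> Z \<Longrightarrow> r > 0 \<Longrightarrow> \<not> packing_sigma_finite e s (Z \<inter> mball_of (X 0) x r)"
    and e: "e \<ge> 0" and S: "stage e s Z i S"
  shows "\<exists>S'. stage e s Z (Suc i) S' \<and> refines S S'"
proof -
  obtain E m r f where SE: "S = (E, m, r, f)"
    by (cases S) auto
  have E: "finite E" "E \<subseteq> Z" "0 < r" "\<And>x. x \<in> E \<Longrightarrow> i < m x"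
    "\<And>x y z w. x \<in> E \<Longrightarrow> y \<in> E \<Longrightarrow> x \<noteq> y \<Longrightarrow> z \<in> M \<Longrightarrow> w \<in> M \<Longrightarrow>
       d x z \<le> r \<Longrightarrow> d y w \<le> r \<Longrightarrow> e < D (m x) z w"
    "\<And>u. f u \<in> E" "\<And>x. x \<in> E \<Longrightarrow> {u. f u = x} \<in> sets borel"
    "\<And>x. x \<in> E \<Longrightarrow> measure unit_uniform {u. f u = x} \<le> exp (- real (m x) * s)"
    using S unfolding SE by auto
  \<comment> \<open>The sum dominates every old order at once, so new Bowen distances dominate old
    ones; \<open>Suc (Suc i)\<close> supplies the orders above \<open>Suc i\<close>.\<close>
  define N where "N = Suc (Suc i) + (\<Sum>x\<in>E. m x)"
  define P where "P x F k \<longleftrightarrow> finite F \<and> F \<subseteq> Z \<inter> mball_of (X 0) x (r / 2) \<and> (\<forall>y\<in>F. N \<le> k y) \<and>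
     (\<forall>y\<in>F. \<forall>z\<in>F. y \<noteq> z \<longrightarrow> e < D (k y) y z) \<and>
     exp (- real (m x) * s) < (\<Sum>y\<in>F. exp (- real (k y) * s))" for x and F and k :: "'a \<Rightarrow> nat"
  have "\<exists>F k. P x F k" if "x \<in> E" for x
    unfolding P_def
  proof (rule ex_large_finite_packing[OF Z(2) _ e])
    show "x \<in> Z" "0 < r / 2" "Z \<inter> mball_of (X 0) x (r / 2) \<subseteq> M"
      using that E(2,3) Z(1) by auto
  qed
  then obtain F k where Fk: "\<And>x. x \<in> E \<Longrightarrow> P x (F x) (k x)"
    by metis
  have F: "\<And>x. x \<in> E \<Longrightarrow> finite (F x)"
     "\<And>x y. x \<in> E \<Longrightarrow> y \<in> F x \<Longrightarrow> y \<in> Z \<and> y \<in> mball_of (X 0) x (r / 2)"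
     "\<And>x y. x \<in> E \<Longrightarrow> y \<in> F x \<Longrightarrow> N \<le> k x y"
     "\<And>x y z. x \<in> E \<Longrightarrow> y \<in> F x \<Longrightarrow> z \<in> F x \<Longrightarrow> y \<noteq> z \<Longrightarrow> e < D (k x y) y z"
     "\<And>x. x \<in> E \<Longrightarrow> exp (- real (m x) * s) < (\<Sum>y\<in>F x. exp (- real (k x y) * s))"
    using Fk unfolding P_def by (simp_all add: subset_iff)
  have Fd: "y \<in> M" "d x y \<le> r / 2" "d x y \<le> r" if "x \<in> E" "y \<in> F x" for x y
    using F(2)[OF that] E(3) by auto
  have mN: "m x \<le> N" if "x \<in> E" for x
    unfolding N_def using member_le_sum[of x E m] that E(1) by auto
  have F_disj: "x = x'" if xy: "x \<in> E" "x' \<in> E" "y \<in> F x" "y \<in> F x'" for x x' y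
  proof (rule ccontr)
    assume "x \<noteq> x'"
    then have "e < D (m x) y y"
      using E(5)[OF xy(1,2), of y y] Fd[OF xy(1,3)] Fd[OF xy(2,4)] by blast
    moreover have "D (m x) y y = 0"
      using E(4)[OF xy(1)] Fd[OF xy(1,3)] by (intro bowen_dist_self) auto
    ultimately show False
      using e by simp
  qed
  define E' where "E' = (\<Union>x\<in>E. F x)"
  define m' where "m' y = k (THE x. x \<in> E \<and> y \<in> F x) y" for y
  have m': "m' y = k x y" if "x \<in> E" "y \<in> F x" for x y
  proof -
    have "(THE x. x \<in> E \<and> y \<in> F x) = x"
      using that F_disj by (intro the_equality) auto
    then show ?thesis
      by (simp add: m'_def)
  qed
  have m'N: "N \<le> m' y" if "y \<in> E'" for y
    using that F(3) m' by (auto simp: E'_def)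
  have E': "finite E'" "E' \<subseteq> Z"
    using E(1) F(1,2) by (auto simp: E'_def)
  \<comment> \<open>Points of one family are separated by their packing. Points of different
    families lie within \<open>r\<close> of distinct old points and inherit the old
    separation.\<close>
  have sep: "e < D (m' y) y z" if yz: "y \<in> E'" "z \<in> E'" "y \<noteq> z" for y z
  proof -
    obtain x x' where x: "x \<in> E" "y \<in> F x" "x' \<in> E" "z \<in> F x'"
      using yz by (auto simp: E'_def)
    show ?thesis
    proof (cases "x = x'")
      case True
      then show ?thesis
        using F(4)[OF x(1,2), of z] x yz(3) m' by auto
    next
      case False
      then have "e < D (m x) y z"
        using E(5)[OF x(1,3), of y z] Fd[OF x(1,2)] Fd[OF x(3,4)] by blast
      also have "\<dots> \<le> D (m' y) y z"
        using E(4)[OF x(1)] mN[OF x(1)] m'N[OF yz(1)] by (intro bowen_dist_mono) auto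
      finally show ?thesis .
    qed
  qed
  have m'pos: "0 < m' y" if "y \<in> E'" for y
    using m'N[OF that] by (simp add: N_def)
  obtain r' where r': "r' > 0" "r' \<le> r / 2" "\<forall>x\<in>E'. \<forall>y\<in>E'. x \<noteq> y \<longrightarrow>
       (\<forall>z\<in>M. \<forall>w\<in>M. d x z \<le> r' \<longrightarrow> d y w \<le> r' \<longrightarrow> e < D (m' x) z w)"
    using ex_separating_radius[OF E'(1) subset_trans[OF E'(2) Z(1)] m'pos sep half_gt_zero[OF E(3)]]
    by blast
  have "\<exists>g. (\<forall>u\<in>{u. f u = x}. g u \<in> F x) \<and> (\<forall>y\<in>F x. {u\<in>{u. f u = x}. g u = y} \<in> sets borel \<and>
      measure unit_uniform {u\<in>{u. f u = x}. g u = y} \<le> exp (- real (k x y) * s))" if x: "x \<in> E" for x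
  proof (rule unit_uniform_ex_partition[OF F(1)[OF x] _ E(7)[OF x]])
    show "F x \<noteq> {}"
      using F(5)[OF x] by (auto simp: not_less[symmetric])
    show "measure unit_uniform {u. f u = x} \<le> (\<Sum>y\<in>F x. exp (- real (k x y) * s))"
      using E(8)[OF x] F(5)[OF x] by simp
  qed auto
  then have "\<exists>g. \<forall>x\<in>E. (\<forall>u\<in>{u. f u = x}. g x u \<in> F x) \<and>
      (\<forall>y\<in>F x. {u\<in>{u. f u = x}. g x u = y} \<in> sets borel \<and>
      measure unit_uniform {u\<in>{u. f u = x}. g x u = y} \<le> exp (- real (k x y) * s))"
    by (intro bchoice) blast
  then obtain g where g': "\<forall>x\<in>E. (\<forall>u\<in>{u. f u = x}. g x u \<in> F x) \<and>
      (\<forall>y\<in>F x. {u\<in>{u. f u = x}. g x u = y} \<in> sets borel \<and>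
      measure unit_uniform {u\<in>{u. f u = x}. g x u = y} \<le> exp (- real (k x y) * s))" ..
  have g: "\<And>u. g (f u) u \<in> F (f u)"
    "\<And>x y. x \<in> E \<Longrightarrow> y \<in> F x \<Longrightarrow> {u. f u = x \<and> g x u = y} \<in> sets borel"
    "\<And>x y. x \<in> E \<Longrightarrow> y \<in> F x \<Longrightarrow>
       measure unit_uniform {u. f u = x \<and> g x u = y} \<le> exp (- real (k x y) * s)"
    using g' E(6) by simp_all
  define f' where "f' u = g (f u) u" for u
  have fib: "{u. f' u = y} = {u. f u = x \<and> g x u = y}" if "x \<in> E" "y \<in> F x" for x y
    using F_disj[OF E(6) that(1) g(1)] that(2) by (auto simp: f'_def)
  have "\<forall>u. f' u \<in> E'"
    using g(1) E(6) by (auto simp: f'_def E'_def)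
  moreover have "\<forall>y\<in>E'. {u. f' u = y} \<in> sets borel \<and>
       measure unit_uniform {u. f' u = y} \<le> exp (- real (m' y) * s)"
    using g(2,3) fib m' by (auto simp: E'_def)
  moreover have "\<forall>y\<in>E'. Suc i < m' y"
    using m'N by (force simp: N_def)
  ultimately have "stage e s Z (Suc i) (E', m', r', f')"
    using E' r' by simp
  moreover have "refines S (E', m', r', f')"
    unfolding SE using r'(2) Fd(2)[OF E(6) g(1)] by (simp add: f'_def)
  ultimately show ?thesis
    by blast
qed

section \<open>The Borel sets of \<open>X 0\<close> and the limit measure on them\<close>

abbreviation borel_X0 :: "'a measure" where
  "borel_X0 \<equiv> sigma M {U. openin (mtopology_of (X 0)) U}"

lemma sets_borel_X0: "sets borel_X0 = sigma_sets M {U. openin (mtopology_of (X 0)) U}"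
  by (rule sets_measure_of) (use openin_subset in fastforce)

lemma closedin_in_sets_borel_X0:
  assumes "closedin (mtopology_of (X 0)) A"
  shows "A \<in> sets borel_X0"
proof -
  have "M - A \<in> sets borel_X0"
    using assms by (auto simp: sets_borel_X0 closedin_def)
  then have "space borel_X0 - (M - A) \<in> sets borel_X0"
    by (rule sets.compl_sets)
  moreover have "space borel_X0 - (M - A) = A"
    using closedin_subset[OF assms] by (auto simp: space_measure_of_conv)
  ultimately show ?thesis by simp
qed

text \<open>The maps \<open>f i\<close> converge uniformly to a map \<open>\<phi>\<close> into
  \<open>K\<close>. Near a limit point, a Bowen ball of order \<open>m i x\<close> only receives
  mass from the fibre of \<open>x\<close>, which bounds its measure.\<close>

lemma ex_measure_upper_entropy_ge:
  assumes K: "compactin (mtopology_of (X 0)) K" and e: "e > 0"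
    and nf: "\<not> packing_sigma_finite e s K"
  shows "\<exists>\<mu>\<in>borel_probs (X 0). measure \<mu> K = 1 \<and> ereal s \<le> upper_entropy X T \<mu>"
proof -
  have KM: "K \<subseteq> M"
    using compactin_subset_topspace[OF K] by simp
  have Kcl: "closedin X0.mtopology K"
    using K by (simp add: mtopology_eq[symmetric] compactin_imp_closedin X0.Hausdorff_space_mtopology)
  obtain Z where Z: "Z \<subseteq> K" "Z \<noteq> {}"
    "\<And>x r. x \<in> Z \<Longrightarrow> r > 0 \<Longrightarrow> \<not> packing_sigma_finite e s (Z \<inter> mball_of (X 0) x r)"
    using packing_sigma_finite_kernel[OF KM nf] by blast
  have ZM: "Z \<subseteq> M"
    using Z(1) KM by blast
  have "\<not> packing_sigma_finite e s Z"
  proof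
    assume "packing_sigma_finite e s Z"
    moreover obtain x where "x \<in> Z" using Z(2) by blast
    ultimately show False
      using Z(3)[of x 1] packing_sigma_finite_subset[of e s Z "Z \<inter> mball_of (X 0) x 1"] by simp
  qed
  then have "\<exists>S. stage e s Z 0 S"
    using e by (intro ex_stage_0[OF ZM]) auto
  then have "\<exists>S. \<forall>i. stage e s Z i (S i) \<and> refines (S i) (S (Suc i))"
    by (rule dependent_nat_choice) (rule ex_stage_Suc[OF ZM Z(3) less_imp_le[OF e]])
  then obtain S where S: "\<And>i. stage e s Z i (S i)" "\<And>i. refines (S i) (S (Suc i))"
    by blast
  define F where "F i = fst (S i)" for i
  define m where "m i = fst (snd (S i))" for i
  define r where "r i = fst (snd (snd (S i)))" for i
  define f where "f i = snd (snd (snd (S i)))" for i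
  have S_eq: "S i = (F i, m i, r i, f i)" for i
    by (simp add: F_def m_def r_def f_def)
  note S' = S[unfolded S_eq stage.simps refines.simps]
  have F: "finite (F i)" "x \<in> F i \<Longrightarrow> x \<in> Z" "x \<in> F i \<Longrightarrow> x \<in> M" "f i u \<in> F i" "0 < r i" for i x u
    using S'(1)[of i] ZM by auto
  have sep: "e < D (m i x) z w"
    if "x \<in> F i" "y \<in> F i" "x \<noteq> y" "z \<in> M" "w \<in> M" "d x z \<le> r i" "d y w \<le> r i" for i x y z w
    using S'(1)[of i] that by blast
  have m_gt: "i < m i x" if "x \<in> F i" for i x
    using S'(1)[of i] that by simp
  have fib: "{u. f i u = x} \<in> sets borel"
    "measure unit_uniform {u. f i u = x} \<le> exp (- real (m i x) * s)" if "x \<in> F i" for i x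
    using S'(1)[of i] that by simp_all
  have step: "r (Suc i) \<le> r i / 2" "d (f i u) (f (Suc i) u) \<le> r i / 2" for i u
    using S'(2)[of i] by simp_all
  have r_le: "r i \<le> r 0 * (1 / 2) ^ i" for i
  proof (induction i)
    case (Suc i)
    then show ?case
      using step(1)[of i] by simp
  qed simp
  have r_small: "\<exists>i. r i < h" if "h > 0" for h
  proof -
    have "(\<lambda>i. r 0 * (1 / 2) ^ i) \<longlonglongrightarrow> r 0 * 0"
      by (intro tendsto_mult tendsto_const LIMSEQ_power_zero) simp
    then have "eventually (\<lambda>i. r 0 * (1 / 2) ^ i < h) sequentially"
      using that by (auto dest: order_tendstoD(2))
    then obtain i where "r 0 * (1 / 2) ^ i < h"
      by (auto simp: eventually_sequentially)
    with r_le[of i] show ?thesis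
      by (intro exI[of _ i]) simp
  qed
  \<comment> \<open>A point of the nested intersection of the closed balls. Cutting with
    \<open>K\<close> places the limit in \<open>K\<close>, since the stages lie in \<open>Z\<close>,
    which may not be closed.\<close>
  have "\<exists>z\<in>K. \<forall>i. d (f i u) z \<le> r i" for u
  proof -
    define C where "C i = X0.mcball (f i u) (r i) \<inter> K" for i
    have "(\<Inter>i. C i) \<noteq> {}"
    proof (rule compact_space_imp_nest)
      show "compact_space X0.mtopology"
        using nds by (simp add: nds_def mtopology_eq)
      show "closedin X0.mtopology (C i)" for i
        unfolding C_def using Kcl by blast
      show "C i \<noteq> {}" for i
      proof -
        have "f i u \<in> C i"
          using F(2)[OF F(4)] F(3)[OF F(4)] F(5)[of i] Z(1) unfolding C_def by (auto intro: less_imp_le)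
        then show ?thesis by blast
      qed
      have "X0.mcball (f (Suc i) u) (r (Suc i)) \<subseteq> X0.mcball (f i u) (r i)" for i
      proof
        fix z assume z: "z \<in> X0.mcball (f (Suc i) u) (r (Suc i))"
        have "d (f i u) z \<le> d (f i u) (f (Suc i) u) + d (f (Suc i) u) z"
          using z F(3)[OF F(4)] by (intro mdist_triangle) auto
        also have "\<dots> \<le> r i / 2 + r i / 2"
          using z step[of i] by (intro add_mono) auto
        finally show "z \<in> X0.mcball (f i u) (r i)"
          using z F(3)[OF F(4)] by auto
      qed
      then show "decseq C"
        unfolding C_def by (intro decseq_SucI) blast
    qed
    then obtain z where "\<And>i. z \<in> C i"
      by blast
    then show ?thesis
      by (intro bexI[of _ z]) (auto simp: C_def)
  qed
  then obtain \<phi> where \<phi>: "\<And>u. \<phi> u \<in> K" "\<And>u i. d (f i u) (\<phi> u) \<le> r i"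
    by metis
  have \<phi>M: "\<phi> u \<in> M" for u
    using \<phi>(1) KM by blast
  \<comment> \<open>Measurability of \<open>\<phi>\<close>: because the radii tend to 0, membership
    of \<open>\<phi> u\<close> in an open set is decided at a finite stage, where there are finitely
    many Borel fibres.\<close>
  have vimage: "\<phi> -` V = (\<Union>i. \<Union>x\<in>{x \<in> F i. X0.mcball x (r i) \<subseteq> V}. {u. f i u = x})"
    if V: "openin X0.mtopology V" for V
  proof (intro antisym subsetI)
    fix u assume "u \<in> \<phi> -` V"
    then obtain h where h: "h > 0" "X0.mball (\<phi> u) h \<subseteq> V"
      using V by (auto simp: X0.openin_mtopology)
    obtain i where i: "r i < h / 2"
      using r_small[of "h / 2"] h(1) by auto
    have "X0.mcball (f i u) (r i) \<subseteq> X0.mball (\<phi> u) h"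
    proof
      fix z assume z: "z \<in> X0.mcball (f i u) (r i)"
      have "d (\<phi> u) z \<le> d (\<phi> u) (f i u) + d (f i u) z"
        using z \<phi>M F(3)[OF F(4)] by (intro mdist_triangle) auto
      also have "\<dots> < h"
        using z i \<phi>(2)[of i u] by (auto simp: mdist_commute)
      finally show "z \<in> X0.mball (\<phi> u) h"
        using z \<phi>M by auto
    qed
    then have "f i u \<in> {x \<in> F i. X0.mcball x (r i) \<subseteq> V}"
      using h(2) F(4) by blast
    then show "u \<in> (\<Union>i. \<Union>x\<in>{x \<in> F i. X0.mcball x (r i) \<subseteq> V}. {u. f i u = x})"
      by blast
  next
    fix u assume "u \<in> (\<Union>i. \<Union>x\<in>{x \<in> F i. X0.mcball x (r i) \<subseteq> V}. {u. f i u = x})"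
    then obtain i where "f i u \<in> F i" "X0.mcball (f i u) (r i) \<subseteq> V"
      by blast
    moreover have "\<phi> u \<in> X0.mcball (f i u) (r i)"
      using \<phi>M \<phi>(2) F(3)[OF F(4)] by auto
    ultimately show "u \<in> \<phi> -` V"
      by blast
  qed
  have meas: "\<phi> \<in> measurable unit_uniform borel_X0"
  proof (rule measurable_measure_of)
    show "{U. openin (mtopology_of (X 0)) U} \<subseteq> Pow M"
      using openin_subset by fastforce
    show "\<phi> \<in> space unit_uniform \<rightarrow> M"
      using \<phi>M by simp
    fix V assume "V \<in> {U. openin (mtopology_of (X 0)) U}"
    then have "\<phi> -` V = (\<Union>i. \<Union>x\<in>{x \<in> F i. X0.mcball x (r i) \<subseteq> V}. {u. f i u = x})"
      by (intro vimage) (simp add: mtopology_eq)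
    also have "\<dots> \<in> sets borel"
      using F(1) fib(1) by (intro sets.countable_UN sets.finite_UN image_subsetI) auto
    finally show "\<phi> -` V \<inter> space unit_uniform \<in> sets unit_uniform"
      by simp
  qed
  define \<mu> where "\<mu> = distr unit_uniform borel_X0 \<phi>"
  interpret U: prob_space unit_uniform
    by (rule prob_space_unit_uniform)
  interpret prob_space \<mu>
    unfolding \<mu>_def using meas by (rule U.prob_space_distr)
  have \<mu>: "\<mu> \<in> borel_probs (X 0)"
    using prob_space_axioms by (simp add: borel_probs_def \<mu>_def sets_borel_X0 space_measure_of_conv)
  have measure_\<mu>: "measure \<mu> A = measure unit_uniform (\<phi> -` A)" if "A \<in> sets borel_X0" for A
    unfolding \<mu>_def using that meas by (simp add: measure_distr)
  have "\<phi> -` K = space unit_uniform"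
    using \<phi>(1) by auto
  then have \<mu>K: "measure \<mu> K = 1"
    using Kcl closedin_in_sets_borel_X0[of K] U.prob_space by (simp add: measure_\<mu> mtopology_eq)
  \<comment> \<open>A closed, hence Borel, set containing the range of \<open>\<phi>\<close>; it
    replaces the range, whose measurability is not established.\<close>
  define Y where "Y = (\<Inter>i. \<Union>x\<in>F i. X0.mcball x (r i))"
  have "Y \<in> sets borel_X0"
    unfolding Y_def using F(1)
    by (intro closedin_in_sets_borel_X0 closedin_Inter)
       (auto intro!: closedin_Union simp flip: mtopology_eq)
  have rate: "ereal s \<le> local_upper_entropy X T \<mu> z" if z: "z \<in> Y" for z
  proof -
    have zM: "z \<in> M"
      using z by (auto simp: Y_def)
    \<comment> \<open>The orders \<open>m i x\<close> exceed \<open>i\<close>, so the good orders at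
      \<open>z\<close> are unbounded, as the limsup requires.\<close>
    have ex: "\<exists>n>i. ereal s \<le> - elog (measure \<mu> (B n z e)) / ereal (real n)" for i
    proof -
      obtain x where x: "x \<in> F i" "d x z \<le> r i"
        using z by (auto simp: Y_def)
      have n: "0 < m i x"
        using m_gt[OF x(1)] by simp
      have "B (m i x) z e \<in> sets borel_X0"
        using bowen_ball_in_sets[OF \<mu> n zM, of e] by (simp add: \<mu>_def)
      then have "measure \<mu> (B (m i x) z e) = measure unit_uniform (\<phi> -` B (m i x) z e)"
        by (rule measure_\<mu>)
      also have "\<dots> \<le> measure unit_uniform {u. f i u = x}"
      proof (rule U.finite_measure_mono)
        show "\<phi> -` B (m i x) z e \<subseteq> {u. f i u = x}"
        \<comment> \<open>\<open>z\<close> is within \<open>r i\<close> of \<open>x\<close>, and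
          \<open>\<phi> u\<close> within \<open>r i\<close> of \<open>f i u\<close>; were these
          stage points distinct, separation would put \<open>\<phi> u\<close> outside the
          ball.\<close>
        proof (clarify, rule ccontr)
          fix u assume u: "\<phi> u \<in> B (m i x) z e" "f i u \<noteq> x"
          have "e < D (m i x) z (\<phi> u)"
            using sep[OF x(1) F(4) not_sym[OF u(2)] zM \<phi>M x(2) \<phi>(2)] .
          with u(1) show False
            by (simp add: bowen_ball_def)
        qed
      qed (use fib(1)[OF x(1)] in simp)
      also have "\<dots> \<le> exp (- real (m i x) * s)"
        by (rule fib(2)[OF x(1)])
      finally have "ereal s \<le> - elog (measure \<mu> (B (m i x) z e)) / ereal (real (m i x))"
        using n by (intro le_minus_elog_divide) auto
      with m_gt[OF x(1)] show ?thesis by blast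
    qed
    have "ereal s \<le> local_rate \<mu> z e"
    proof (rule ccontr)
      assume "\<not> ?thesis"
      then have "eventually (\<lambda>n. - elog (measure \<mu> (B n z e)) / ereal (real n) < ereal s) sequentially"
        by (intro Limsup_lessD) (simp add: not_le)
      then obtain i where i: "\<And>n. n \<ge> i \<Longrightarrow> - elog (measure \<mu> (B n z e)) / ereal (real n) < ereal s"
        unfolding eventually_sequentially by blast
      obtain n where "n > i" "ereal s \<le> - elog (measure \<mu> (B n z e)) / ereal (real n)"
        using ex by blast
      with i[of n] show False by simp
    qed
    also have "\<dots> \<le> local_upper_entropy X T \<mu> z"
      unfolding local_upper_entropy_eq_SUP[OF \<mu> zM] using e by (intro SUP_upper) simp
    finally show ?thesis .
  qed
  have "\<phi> u \<in> Y" for u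
    unfolding Y_def using F(3,4) \<phi>(2) \<phi>M by fastforce
  then have "AE z in \<mu>. z \<in> Y"
    unfolding \<mu>_def using \<open>Y \<in> sets borel_X0\<close> meas by (subst AE_distr_iff) auto
  then have "(\<integral>\<^sup>+ z. e2ennreal (ereal s) \<partial>\<mu>) \<le> (\<integral>\<^sup>+ z. e2ennreal (local_upper_entropy X T \<mu> z) \<partial>\<mu>)"
    by (intro nn_integral_mono_AE) (auto elim!: eventually_mono intro: e2ennreal_mono rate simp del: e2ennreal_ereal)
  then have "enn2ereal (e2ennreal (ereal s)) \<le> upper_entropy X T \<mu>"
    by (simp add: emeasure_space_1 upper_entropy_def less_eq_ennreal.rep_eq)
  \<comment> \<open>For negative \<open>s\<close> the truncation yields 0, which is still at least
    \<open>s\<close>.\<close>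
  moreover have "ereal s \<le> enn2ereal (e2ennreal (ereal s))"
    by (cases "s \<ge> 0") (auto simp: enn2ereal_e2ennreal intro: order_trans[OF _ enn2ereal_nonneg])
  ultimately show ?thesis
    using \<mu> \<mu>K order_trans by blast
qed

theorem packing_entropy_le_Sup_upper_entropy:
  assumes K: "compactin (mtopology_of (X 0)) K"
  shows "packing_entropy X T K \<le>
    Sup {upper_entropy X T \<mu> | \<mu>. \<mu> \<in> borel_probs (X 0) \<and> measure \<mu> K = 1}" (is "_ \<le> ?S")
  unfolding packing_entropy_eq_SUP
proof (rule SUP_least, rule dense_le)
  fix e :: real and y
  assume "e \<in> {0<..}" and "y < Inf {ereal s | s. packing_outer X T e s K = 0}"
  then obtain t where t: "y < ereal t" "ereal t < Inf {ereal s | s. packing_outer X T e s K = 0}"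
    using ereal_dense2 by blast
  \<comment> \<open>The gap between \<open>s\<close> and \<open>t\<close> absorbs the loss of
    exponent in \<open>packing_outer_eq_0_if_sigma_finite\<close>.\<close>
  obtain s where s: "y < ereal s" "s < t"
    using ereal_dense2[OF t(1)] by auto
  have "packing_outer X T e t K \<noteq> 0"
  proof
    assume "packing_outer X T e t K = 0"
    then have "Inf {ereal s | s. packing_outer X T e s K = 0} \<le> ereal t"
      by (intro Inf_lower) blast
    with t(2) show False by simp
  qed
  then have "\<not> packing_sigma_finite e s K"
    using packing_outer_eq_0_if_sigma_finite s(2) by blast
  then obtain \<mu> where \<mu>: "\<mu> \<in> borel_probs (X 0)" "measure \<mu> K = 1" "ereal s \<le> upper_entropy X T \<mu>"
    using ex_measure_upper_entropy_ge[OF K] \<open>e \<in> {0<..}\<close> by force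
  have "y \<le> upper_entropy X T \<mu>"
    using s(1) \<mu>(3) by simp
  also have "\<dots> \<le> ?S"
    using \<mu> by (intro Sup_upper) blast
  finally show "y \<le> ?S" .
qed

end

theorem corollary2p12:
  fixes X :: "nat \<Rightarrow> 'a metric" and T :: "nat \<Rightarrow> 'a \<Rightarrow> 'a" and K :: "'a set"
  assumes "nds X T"
    and "K \<noteq> {}"
    and "compactin (mtopology_of (X 0)) K"
  shows "packing_entropy X T K =
    Sup {upper_entropy X T \<mu> | \<mu>. \<mu> \<in> borel_probs (X 0) \<and> measure \<mu> K = 1}"
proof (rule antisym)
  interpret nonautonomous_system X T
    using assms(1) by unfold_locales
  have "K \<subseteq> mspace (X 0)"
    using compactin_subset_topspace[OF assms(3)] by simp
  then show "Sup {upper_entropy X T \<mu> | \<mu>. \<mu> \<in> borel_probs (X 0) \<and> measure \<mu> K = 1}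
      \<le> packing_entropy X T K"
    by (intro Sup_least) (auto intro: upper_entropy_le_packing_entropy)
  show "packing_entropy X T K \<le>
    Sup {upper_entropy X T \<mu> | \<mu>. \<mu> \<in> borel_probs (X 0) \<and> measure \<mu> K = 1}"
    using assms(3) by (rule packing_entropy_le_Sup_upper_entropy)
qed

end
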